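(* Let $\mathbf P(t)=(P_{\mathrm{in}}(t),P_{\mathrm{out}}(t))$ be a pair of inscribed convex triangles associated to a positive triple of flags in $\mathbb R^3$ with triple ratio $t\in(0,\infty)$. Then the Holmes--Thompson area of $P_{\mathrm{in}}(t)$ with respect to the Hilbert metric on $P_{\mathrm{out}}(t)$ is \[ \mathrm{vol}^{\mathrm{HT}}(\mathbf P(t))=\frac{3}{8\pi}\left(\pi^2+\ln^2(t)\right). \]
   Context: **Flags.** A flag $F$ in $\mathbb R^3$ is a pair of subspaces $F^1\subset F^2$, $\dim F^i=i$, represented by $(f_1,f_2)$ with $F^1=\langle f_1\rangle$, $F^2=\langle f_1,f_2\rangle$. A triple $(E,F,G)$ is in general position if $E^a+F^b+G^c=\mathbb R^3$ whenever $a,b,c\in\{0,1,2\}$, $a+b+c=3$ (with $E^0=0$ etc.). Reading $u\wedge v\wedge w$ as $\det(u,v,w)$, its triple ratio is \[T(E,F,G)=\frac{e_1\wedge e_2\wedge f_1}{f_1\wedge g_1\wedge g_2}\cdot\frac{e_1\wedge g_1\wedge g_2}{e_1\wedge f_1\wedge f_2}\cdot\frac{f_1\wedge f_2\wedge g_1}{e_1\wedge e_2\wedge g_1},\] and the triple is positive if $T(E,F,G)>0$. A positive triple determines a pair of triangles in $\mathbb{RP}^2$ (bounded triangles in a suitable affine chart): $P_{\mathrm{in}}$ with vertices $E^1,F^1,G^1$, inscribed in $P_{\mathrm{out}}$ with vertices $E^2\cap F^2,F^2\cap G^2,G^2\cap E^2$, each side of $P_{\mathrm{out}}$ containing exactly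 one vertex of $P_{\mathrm{in}}$ in its interior. Positive triples with the same triple ratio are in the same $\mathsf{PGL}_3(\mathbb R)$-orbit. (A normalized representative: $P_{\mathrm{out}}$ has vertices $(0,0),(2,0),(0,2)$ and $P_{\mathrm{in}}$ has vertices $(1,1),(1,0),(0,s)$ with $s=\frac{2t}{t+1}$.) **Holmes--Thompson area.** For a bounded open convex $\Omega\subset\mathbb R^2$ (an affine chart), $p\in\Omega$, $0\neq\xi\in\mathbb R^2$, let $v^\pm\in\partial\Omega$ be the forward/backward intersection points with $\partial\Omega$ of the line through $p$ directed by $\xi$ and write $\xi=\sigma^+(v^+-p)=\sigma^-(p-v^-)$, $\sigma^\pm>0$; the Hilbert Finsler norm is $\|\xi\|_{\Omega,p}=\frac12(\sigma^++\sigma^-)$. With $B_p$ its closed unit ball and $B_p^*=\{\eta:\langle\eta,\xi\rangle\le1\ \forall\xi\in B_p\}$, $\mathrm{vol}^{\mathrm{HT}}_\Omega(X)=\frac1\pi\int_X|B^*_p|\,dp$; this is $\mathsf{PGL}_3(\mathbb R)$-invariant. $\mathrm{vol}^{\mathrm{HT}}(\mathbf P)$ means $\mathrm{vol}^{\mathrm{HT}}_{P_{\mathrm{out}}}(P_{\mathrm{in}})$ (using interiors). *)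

theory Defs
  imports "HOL-Analysis.Analysis" "HOL-Library.Set_Algebras"
begin

text \<open>A flag is indexed by dimension, \<open>F i\<close> for \<open>i \<le> 2\<close>; the condition at \<open>i = 0\<close> says \<open>F 0 = {0}\<close>.
  Values at \<open>i > 2\<close> are irrelevant.\<close>

definition flag :: "(nat \<Rightarrow> (real^3) set) \<Rightarrow> bool" where
  "flag F \<longleftrightarrow> (\<forall>i\<le>2. subspace (F i) \<and> dim (F i) = i) \<and> F 1 \<subseteq> F 2"

definition represents :: "real^3 \<Rightarrow> real^3 \<Rightarrow> (nat \<Rightarrow> (real^3) set) \<Rightarrow> bool" where
  "represents f1 f2 F \<longleftrightarrow> F 1 = span {f1} \<and> F 2 = span {f1, f2}"

definition general_position ::
  "(nat \<Rightarrow> (real^3) set) \<Rightarrow> (nat \<Rightarrow> (real^3) set) \<Rightarrow> (nat \<Rightarrow> (real^3) set) \<Rightarrow> bool" where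
  "general_position E F G \<longleftrightarrow>
     (\<forall>a b c. a \<le> 2 \<and> b \<le> 2 \<and> c \<le> 2 \<and> a + b + c = 3 \<longrightarrow> E a + F b + G c = UNIV)"

definition det3 :: "real^3 \<Rightarrow> real^3 \<Rightarrow> real^3 \<Rightarrow> real" where
  "det3 u v w = det (vector [u, v, w] :: real^3^3)"

definition triple_ratio ::
  "real^3 \<Rightarrow> real^3 \<Rightarrow> real^3 \<Rightarrow> real^3 \<Rightarrow> real^3 \<Rightarrow> real^3 \<Rightarrow> real" where
  "triple_ratio e1 e2 f1 f2 g1 g2 =
     (det3 e1 e2 f1 / det3 f1 g1 g2) *
     (det3 e1 g1 g2 / det3 e1 f1 f2) *
     (det3 f1 f2 g1 / det3 e1 e2 g1)"

text \<open>An invertible matrix \<open>A\<close> gives the affine chart of the projective plane in which the line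
  \<open>L = \<langle>v\<rangle>\<close> has coordinates \<open>((A v)\<^sub>1 / (A v)\<^sub>3, (A v)\<^sub>2 / (A v)\<^sub>3)\<close>. The relation below says that \<open>L\<close>
  is one-dimensional, lies in the domain of this chart and has coordinates \<open>x\<close>.\<close>

definition chart_coords :: "real^3^3 \<Rightarrow> (real^3) set \<Rightarrow> real^2 \<Rightarrow> bool" where
  "chart_coords A L x \<longleftrightarrow>
     invertible A \<and> (\<lambda>v. A *v v) ` L = span {vector [x $ 1, x $ 2, 1]}"

text \<open>Three non-collinear points are the vertices of four triangles in the projective plane. The pair
  meant here is singled out by requiring a chart in which the outer triangle is the ordinary bounded
  triangle and the vertices of the inner one lie in the interiors of its sides. The vertex \<open>E 1\<close> lies
  on the line \<open>E 2\<close>, which carries the side from \<open>G 2 \<inter> E 2\<close> to \<open>E 2 \<inter> F 2\<close>, and similarly for the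
  other two. Both triangles are open subsets of the chart.\<close>

definition inscribed_triangles ::
  "(nat \<Rightarrow> (real^3) set) \<Rightarrow> (nat \<Rightarrow> (real^3) set) \<Rightarrow> (nat \<Rightarrow> (real^3) set) \<Rightarrow>
   real^3^3 \<Rightarrow> (real^2) set \<Rightarrow> (real^2) set \<Rightarrow> bool" where
  "inscribed_triangles E F G A Pin Pout \<longleftrightarrow>
     (\<exists>p q r u v w.
        chart_coords A (E 1) p \<and> chart_coords A (F 1) q \<and> chart_coords A (G 1) r \<and>
        chart_coords A (E 2 \<inter> F 2) u \<and> chart_coords A (F 2 \<inter> G 2) v \<and>
        chart_coords A (G 2 \<inter> E 2) w \<and>
        p \<in> open_segment w u \<and> q \<in> open_segment u v \<and> r \<in> open_segment v w \<and>
        Pin = interior (convex hull {p, q, r}) \<and>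
        Pout = interior (convex hull {u, v, w}))"

text \<open>Only meaningful for \<open>\<Omega>\<close> bounded, open and convex, \<open>p \<in> \<Omega>\<close> and \<open>\<xi> \<noteq> 0\<close>; then the descriptions are
  proper, and \<open>v\<close> is the forward resp. backward boundary point of the line through \<open>p\<close> directed by \<open>\<xi>\<close>.\<close>

definition sigma_plus :: "(real^2) set \<Rightarrow> real^2 \<Rightarrow> real^2 \<Rightarrow> real" where
  "sigma_plus \<Omega> p \<xi> = (THE \<sigma>. \<sigma> > 0 \<and> (\<exists>v\<in>frontier \<Omega>. \<xi> = \<sigma> *\<^sub>R (v - p)))"

definition sigma_minus :: "(real^2) set \<Rightarrow> real^2 \<Rightarrow> real^2 \<Rightarrow> real" where
  "sigma_minus \<Omega> p \<xi> = (THE \<sigma>. \<sigma> > 0 \<and> (\<exists>v\<in>frontier \<Omega>. \<xi> = \<sigma> *\<^sub>R (p - v)))"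

definition hilbert_norm :: "(real^2) set \<Rightarrow> real^2 \<Rightarrow> real^2 \<Rightarrow> real" where
  "hilbert_norm \<Omega> p \<xi> =
     (if \<xi> = 0 then 0 else (sigma_plus \<Omega> p \<xi> + sigma_minus \<Omega> p \<xi>) / 2)"

definition unit_ball :: "(real^2) set \<Rightarrow> real^2 \<Rightarrow> (real^2) set" where
  "unit_ball \<Omega> p = {\<xi>. hilbert_norm \<Omega> p \<xi> \<le> 1}"

definition dual_unit_ball :: "(real^2) set \<Rightarrow> real^2 \<Rightarrow> (real^2) set" where
  "dual_unit_ball \<Omega> p = {\<eta>. \<forall>\<xi>\<in>unit_ball \<Omega> p. \<eta> \<bullet> \<xi> \<le> 1}"

definition holmes_thompson_area :: "(real^2) set \<Rightarrow> (real^2) set \<Rightarrow> ennreal" where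
  "holmes_thompson_area \<Omega> X =
     ennreal (1 / pi) * (\<integral>\<^sup>+p\<in>X. emeasure lborel (dual_unit_ball \<Omega> p) \<partial>lborel)"

end

theory Submission
  imports Defs
begin

text \<open>In the chart of logarithms of homogeneous coordinates, the Hilbert metric of a triangle is a
  translation-invariant hexagonal norm, whose dual unit ball has constant area. The Holmes--Thompson
  area is therefore \<open>3 / (4\<pi>)\<close> times the Euclidean area of the image of the inner triangle. After a
  translation, this image is bounded by the three curves \<open>exp s + exp \<tau> = 1\<close>, \<open>exp \<tau> = 1 + t exp s\<close>
  and \<open>exp \<tau> = t (exp s - 1)\<close>, where \<open>t\<close> is the triple ratio. Integrating over \<open>s < 0\<close> and \<open>s > 0\<close>
  separately, its area is \<open>K (ln t) + K (- ln t) + 2 B\<close>, where \<open>K l\<close> and \<open>B\<close> are the integrals of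
  \<open>ln (1 + exp (l - s))\<close> and \<open>- ln (1 - exp (- s))\<close> over \<open>s > 0\<close>. The power series of the logarithm
  gives \<open>B = \<pi>\<^sup>2 / 6\<close>, the factorisation of \<open>1 - exp (- 2 s)\<close> gives \<open>K 0 = B / 2\<close>, and
  \<open>ln (1 + exp s) - ln (1 + exp (- s)) = s\<close> gives \<open>K l + K (- l) = 2 K 0 + l\<^sup>2 / 2\<close>.\<close>

section \<open>Area of the logarithmic region\<close>

lemma nn_integral_exp_decay:
  fixes c :: real
  assumes "c > 0"
  shows "(\<integral>\<^sup>+s. ennreal (exp (- (c * s))) * indicator {0<..} s \<partial>lborel) = ennreal (1 / c)"
proof -
  have "((\<lambda>s. - exp (- (c * s)) / c) \<longlongrightarrow> 0) at_top"
  proof -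
    have "filterlim (\<lambda>s. - (c * s)) at_bot at_top"
      using assms by (simp add: filterlim_uminus_at_bot filterlim_tendsto_pos_mult_at_top[OF tendsto_const _ filterlim_ident])
    then have "((\<lambda>s. exp (- (c * s))) \<longlongrightarrow> 0) at_top"
      by (rule filterlim_compose[OF exp_at_bot])
    from tendsto_divide[OF tendsto_minus[OF this] tendsto_const[of c]] show ?thesis using assms by simp
  qed
  then have "(\<integral>\<^sup>+s. ennreal (exp (- (c * s))) * indicator {0..} s \<partial>lborel)
      = ennreal (0 - (- exp (- (c * 0)) / c))"
    using assms by (intro nn_integral_FTC_atLeast) (auto intro!: derivative_eq_intros simp: field_simps)
  moreover have "(\<integral>\<^sup>+s. ennreal (exp (- (c * s))) * indicator {0<..} s \<partial>lborel)
      = (\<integral>\<^sup>+s. ennreal (exp (- (c * s))) * indicator {0..} s \<partial>lborel)"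
    by (rule nn_integral_cong_AE) (use AE_lborel_singleton[of "0::real"] in \<open>eventually_elim, auto simp: indicator_def\<close>)
  ultimately show ?thesis by simp
qed

lemma minus_ln_one_minus_sums:
  fixes x :: real
  assumes "0 \<le> x" "x < 1"
  shows "(\<lambda>n. x ^ Suc n / real (Suc n)) sums (- ln (1 - x))"
proof -
  have "(\<lambda>n. - ((- (- x)) ^ n) / of_nat n) sums ln (1 + (- x))"
    using assms by (intro ln_series') auto
  from sums_minus[OF this] have "(\<lambda>n. x ^ n / of_nat n) sums (- ln (1 - x))" by simp
  then show ?thesis by (subst sums_Suc_iff) simp
qed

text \<open>The terms of the logarithm series at \<open>exp (- s)\<close> are nonnegative, so the
  series may be integrated termwise. The factor \<open>1 / (n + 1)\<close> occurs twice, once as a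
  coefficient and once as the integral of the exponential, and the Basel sum remains.\<close>

lemma nn_integral_ln_one_minus_exp:
  "(\<integral>\<^sup>+s. ennreal (- ln (1 - exp (- s))) * indicator {0<..} s \<partial>lborel) = ennreal (pi\<^sup>2 / 6)"
proof -
  have "(\<integral>\<^sup>+s. ennreal (- ln (1 - exp (- s))) * indicator {0<..} s \<partial>lborel)
     = (\<integral>\<^sup>+s. (\<Sum>n. ennreal (1 / real (Suc n)) * (ennreal (exp (- (real (Suc n) * s))) * indicator {0<..} s)) \<partial>lborel)"
  proof (rule nn_integral_cong)
    fix s :: real
    show "ennreal (- ln (1 - exp (- s))) * indicator {0<..} s
      = (\<Sum>n. ennreal (1 / real (Suc n)) * (ennreal (exp (- (real (Suc n) * s))) * indicator {0<..} s))"
    proof (cases "s > 0")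
      case True
      have sums: "(\<lambda>n. exp (- s) ^ Suc n / real (Suc n)) sums (- ln (1 - exp (- s)))"
        using True by (intro minus_ln_one_minus_sums) auto
      have eq: "exp (- s) ^ Suc n / real (Suc n) = 1 / real (Suc n) * exp (- (real (Suc n) * s))" for n
        by (simp only: exp_of_nat_mult[symmetric]) simp
      have *: "(\<lambda>n. 1 / real (Suc n) * exp (- (real (Suc n) * s))) sums (- ln (1 - exp (- s)))"
        using sums unfolding eq .
      have "(\<Sum>n. ennreal (1 / real (Suc n) * exp (- (real (Suc n) * s)))) = ennreal (- ln (1 - exp (- s)))"
        by (rule suminf_ennreal_eq[OF _ *]) simp
      then show ?thesis using True by (simp flip: ennreal_mult del: of_nat_Suc)
    qed simp
  qed
  also have "\<dots> = (\<Sum>n. ennreal (1 / real (Suc n)) * ennreal (1 / real (Suc n)))"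
    by (subst nn_integral_suminf) (simp_all add: nn_integral_cmult nn_integral_exp_decay del: of_nat_Suc)
  also have "\<dots> = (\<Sum>n. ennreal (1 / (real n + 1)\<^sup>2))"
    by (intro suminf_cong) (simp flip: ennreal_mult add: power2_eq_square add.commute)
  also have "\<dots> = ennreal (pi\<^sup>2 / 6)"
    using inverse_squares_sums by (intro suminf_ennreal_eq) (simp_all add: add.commute)
  finally show ?thesis .
qed

text \<open>For the two integrands below, the factorisation gives
  \<open>?f s = ?g s + ?f (2 * s)\<close>. Rescaling halves the integral of the last term, so
  \<open>?g\<close> carries the other half.\<close>

lemma nn_integral_ln_one_plus_exp:
  "(\<integral>\<^sup>+s. ennreal (ln (1 + exp (- s))) * indicator {0<..} s \<partial>lborel) = ennreal (pi\<^sup>2 / 12)" (is "?K = _")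
proof -
  let ?f = "\<lambda>s::real. ennreal (- ln (1 - exp (- s))) * indicator {0<..} s"
  let ?g = "\<lambda>s::real. ennreal (ln (1 + exp (- s))) * indicator {0<..} s"
  have "?f s = ?g s + ?f (0 + 2 * s)" for s
  proof (cases "s > 0")
    case True
    have e: "exp (- (2 * s)) = exp (- s) * exp (- s)" by (simp flip: exp_add)
    have "ln (1 - exp (- (2 * s))) = ln ((1 + exp (- s)) * (1 - exp (- s)))"
      unfolding e by (simp add: algebra_simps)
    also have "\<dots> = ln (1 + exp (- s)) + ln (1 - exp (- s))"
      using True by (intro ln_mult_pos) (auto intro: add_pos_pos)
    finally have "- ln (1 - exp (- s)) = ln (1 + exp (- s)) + - ln (1 - exp (- (2 * s)))" by simp
    moreover have "0 \<le> - ln (1 - exp (- (2 * s)))" using True by simp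
    ultimately show ?thesis using True by (simp flip: ennreal_plus)
  qed simp
  then have "(\<integral>\<^sup>+s. ?f s \<partial>lborel) = (\<integral>\<^sup>+s. ?g s + ?f (0 + 2 * s) \<partial>lborel)"
    by (intro nn_integral_cong)
  also have "\<dots> = ?K + (\<integral>\<^sup>+s. ?f (0 + 2 * s) \<partial>lborel)"
    by (intro nn_integral_add) measurable
  finally have 1: "ennreal (pi\<^sup>2 / 6) = ?K + (\<integral>\<^sup>+s. ?f (0 + 2 * s) \<partial>lborel)"
    by (simp only: nn_integral_ln_one_minus_exp)
  have "(\<integral>\<^sup>+s. ?f s \<partial>lborel) = ennreal \<bar>2\<bar> * (\<integral>\<^sup>+s. ?f (0 + 2 * s) \<partial>lborel)"
    by (rule nn_integral_real_affine) auto
  then have 2: "ennreal (pi\<^sup>2 / 6) = 2 * (\<integral>\<^sup>+s. ?f (0 + 2 * s) \<partial>lborel)"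
    by (simp only: nn_integral_ln_one_minus_exp) simp
  \<comment> \<open>Both summands are bounded by a finite total, so the two equations can be solved
    over the reals, where subtraction is safe.\<close>
  obtain b where b: "(\<integral>\<^sup>+s. ?f (0 + 2 * s) \<partial>lborel) = ennreal b" "b \<ge> 0"
    using 1 by (cases "(\<integral>\<^sup>+s. ?f (0 + 2 * s) \<partial>lborel)") auto
  obtain k where k: "?K = ennreal k" "k \<ge> 0"
    using 1 by (cases ?K) auto
  have b': "b = pi\<^sup>2 / 12"
    using 2 b(2) unfolding b(1) by (simp flip: ennreal_numeral ennreal_mult)
  have "k = pi\<^sup>2 / 12"
    using 1 b(2) k(2) b' unfolding b(1) k(1) by (simp flip: ennreal_plus)
  then show ?thesis using k by simp
qed

text \<open>The substitution of \<open>l - s\<close> for \<open>s\<close> turns \<open>?K\<close>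
  into the integral of \<open>ln (1 + exp s)\<close> over \<open>s < l\<close>. The part
  \<open>s < 0\<close> gives \<open>K0\<close>; between \<open>0\<close> and \<open>l\<close> the
  integrand is \<open>s + ln (1 + exp (- s))\<close>, which gives \<open>l^2 / 2 + c\<close>.
  Translation turns \<open>?K'\<close> into the tail beyond \<open>l\<close>, which is
  \<open>K0\<close> without \<open>c\<close>, so \<open>c\<close> cancels in the sum.\<close>

lemma nn_integral_ln_one_plus_exp_shift_pos:
  fixes l :: real
  assumes "l \<ge> 0"
  shows "(\<integral>\<^sup>+s. ennreal (ln (1 + exp (l - s))) * indicator {0<..} s \<partial>lborel)
       + (\<integral>\<^sup>+s. ennreal (ln (1 + exp (- l - s))) * indicator {0<..} s \<partial>lborel)
       = ennreal (pi\<^sup>2 / 6 + l\<^sup>2 / 2)" (is "?K + ?K' = _")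
proof -
  let ?p = "\<lambda>s::real. ennreal (ln (1 + exp s))"
  let ?n = "\<lambda>s::real. ennreal (ln (1 + exp (- s)))"
  define K0 where "K0 = ennreal (pi\<^sup>2 / 12)"
  define c where "c = (\<integral>\<^sup>+s. ?n s * indicator {0<..l} s \<partial>lborel)"
  have "?K = ennreal \<bar>-1\<bar> * (\<integral>\<^sup>+s. ennreal (ln (1 + exp (l - (l + (-1) * s)))) * indicator {0<..} (l + (-1) * s) \<partial>lborel)"
    by (rule nn_integral_real_affine) auto
  also have "\<dots> = (\<integral>\<^sup>+s. ?p s * indicator {..<l} s \<partial>lborel)"
    by (auto intro!: nn_integral_cong simp: indicator_def)
  also have "\<dots> = (\<integral>\<^sup>+s. ?p s * indicator {..<0} s + (ennreal s * indicator {0..l} s + ?n s * indicator {0<..l} s) \<partial>lborel)"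
  proof (rule nn_integral_cong_AE)
    have *: "?p s = ennreal s + ?n s" if "s \<ge> 0" for s
    proof -
      have "ln (1 + exp s) = ln (exp s * (1 + exp (- s)))" by (simp add: algebra_simps flip: exp_add)
      also have "\<dots> = s + ln (1 + exp (- s))"
        by (subst ln_mult_pos) (auto intro: add_pos_pos)
      finally show ?thesis using that by simp
    qed
    show "AE s in lborel. ?p s * indicator {..<l} s
        = ?p s * indicator {..<0} s + (ennreal s * indicator {0..l} s + ?n s * indicator {0<..l} s)"
      using AE_lborel_singleton[of "0::real"] AE_lborel_singleton[of l]
      by eventually_elim (use assms * in \<open>auto simp: indicator_def\<close>)
  qed
  also have "\<dots> = (\<integral>\<^sup>+s. ?p s * indicator {..<0} s \<partial>lborel) + ((\<integral>\<^sup>+s. ennreal s * indicator {0..l} s \<partial>lborel) + c)"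
    unfolding c_def by (subst nn_integral_add, simp, simp, subst nn_integral_add) auto
  also have "(\<integral>\<^sup>+s. ?p s * indicator {..<0} s \<partial>lborel) = ennreal \<bar>-1\<bar> * (\<integral>\<^sup>+s. ?p (0 + (-1) * s) * indicator {..<0} (0 + (-1) * s) \<partial>lborel)"
    by (rule nn_integral_real_affine) auto
  also have "\<dots> = (\<integral>\<^sup>+s. ?n s * indicator {0<..} s \<partial>lborel)"
    by (auto intro!: nn_integral_cong simp: indicator_def)
  also have "\<dots> = K0" unfolding K0_def by (rule nn_integral_ln_one_plus_exp)
  also have "(\<integral>\<^sup>+s. ennreal s * indicator {0..l} s \<partial>lborel) = ennreal (l\<^sup>2 / 2 - 0\<^sup>2 / 2)"
    using assms by (intro nn_integral_FTC_Icc) (auto intro!: derivative_eq_intros)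
  finally have K: "?K = K0 + (ennreal (l\<^sup>2 / 2) + c)" by simp
  have "?K' = ennreal \<bar>1\<bar> * (\<integral>\<^sup>+s. ennreal (ln (1 + exp (- l - (- l + 1 * s)))) * indicator {0<..} (- l + 1 * s) \<partial>lborel)"
    by (rule nn_integral_real_affine) auto
  also have "\<dots> = (\<integral>\<^sup>+s. ?n s * indicator {l<..} s \<partial>lborel)"
    by (auto intro!: nn_integral_cong simp: indicator_def)
  finally have "?K' + c = (\<integral>\<^sup>+s. ?n s * indicator {l<..} s + ?n s * indicator {0<..l} s \<partial>lborel)"
    unfolding c_def by (simp add: nn_integral_add)
  also have "\<dots> = (\<integral>\<^sup>+s. ?n s * indicator {0<..} s \<partial>lborel)"
    using assms by (intro nn_integral_cong) (auto simp: indicator_def)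
  finally have K': "?K' + c = K0"
    unfolding K0_def using nn_integral_ln_one_plus_exp by simp
  obtain c' where c': "c = ennreal c'" "c' \<ge> 0"
    using K' unfolding K0_def by (cases c) auto
  obtain k' where k': "?K' = ennreal k'" "k' \<ge> 0"
    using K' unfolding K0_def by (cases ?K') auto
  have "k' + c' = pi\<^sup>2 / 12"
    using K' c'(2) k'(2) unfolding c'(1) k'(1) K0_def by (simp flip: ennreal_plus)
  then show ?thesis
    unfolding K unfolding k'(1) c'(1) K0_def using c'(2) k'(2) by (simp flip: ennreal_plus)
qed

lemma nn_integral_ln_one_plus_exp_shift:
  fixes l :: real
  shows "(\<integral>\<^sup>+s. ennreal (ln (1 + exp (l - s))) * indicator {0<..} s \<partial>lborel)
       + (\<integral>\<^sup>+s. ennreal (ln (1 + exp (- l - s))) * indicator {0<..} s \<partial>lborel)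
       = ennreal (pi\<^sup>2 / 6 + l\<^sup>2 / 2)"
  using nn_integral_ln_one_plus_exp_shift_pos[of l] nn_integral_ln_one_plus_exp_shift_pos[of "-l"]
  by (cases "l \<ge> 0") (auto simp: add.commute)

section \<open>The region between the three curves, by slices\<close>

definition log_region :: "real \<Rightarrow> (real \<times> real) set" where
  "log_region m = {(s, \<tau>). exp s + exp \<tau> > 1 \<and> exp \<tau> < 1 + m * exp s \<and> exp \<tau> > m * (exp s - 1)}"

lemma emeasure_exp_between:
  fixes a b :: real
  assumes "0 < a" "a \<le> b"
  shows "emeasure lborel {\<tau>. a < exp \<tau> \<and> exp \<tau> < b} = ennreal (ln b - ln a)"
proof -
  have "a < exp \<tau> \<longleftrightarrow> ln a < \<tau>" "exp \<tau> < b \<longleftrightarrow> \<tau> < ln b" for \<tau>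
    using assms by (metis exp_less_cancel_iff exp_ln, metis exp_less_cancel_iff exp_ln less_le_trans)
  then have "{\<tau>. a < exp \<tau> \<and> exp \<tau> < b} = {ln a<..<ln b}" by auto
  then show ?thesis using assms by simp
qed

lemma log_region_borel [measurable]: "log_region m \<in> sets borel"
proof -
  have "open (log_region m)"
    unfolding log_region_def case_prod_beta
    by (intro open_Collect_conj open_Collect_less continuous_intros)
  then show ?thesis by simp
qed

text \<open>The slice at \<open>s\<close> always ends at \<open>1 + m * exp s\<close> in the
  variable \<open>exp \<tau>\<close>. It starts at \<open>1 - exp s\<close> for \<open>s < 0\<close>
  and at \<open>m * (exp s - 1)\<close> for \<open>s > 0\<close>; the other lower bound is negative
  in each case.\<close>

lemma emeasure_log_region:
  assumes "m > 0"
  shows "emeasure lborel (log_region m) = ennreal ((pi\<^sup>2 + (ln m)\<^sup>2) / 2)"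
proof -
  let ?b = "\<lambda>s. ennreal (- ln (1 - exp (- s)))"
  let ?k = "\<lambda>l s. ennreal (ln (1 + exp (l - s)))"
  let ?I = "indicator {0<..} :: real \<Rightarrow> ennreal"
  let ?h = "\<lambda>l s. ?k l s * ?I s + ?b s * ?I s"
  have ls: "emeasure lborel (Pair s -` log_region m) = ?h (ln m) (- s)" if "s < 0" for s
  proof -
    have "m * (exp s - 1) < 0" using that assms by (simp add: mult_pos_neg)
    then have "Pair s -` log_region m = {\<tau>. 1 - exp s < exp \<tau> \<and> exp \<tau> < 1 + m * exp s}"
      using less_trans[OF _ exp_gt_zero] by (auto simp: log_region_def)
    moreover have "emeasure lborel \<dots> = ennreal (ln (1 + m * exp s) - ln (1 - exp s))"
      using that assms by (intro emeasure_exp_between) (auto simp: add_nonneg_pos add_increasing2 intro: order_trans[of _ 1])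
    moreover have "0 \<le> ln (1 + m * exp s)" "0 \<le> - ln (1 - exp s)" using assms that by auto
    ultimately show ?thesis using that assms by (simp add: exp_add flip: ennreal_plus)
  qed
  have gs: "emeasure lborel (Pair s -` log_region m) = ?h (- ln m) s" if "s > 0" for s
  proof -
    have "exp s > 1" using that by simp
    then have "Pair s -` log_region m = {\<tau>. m * (exp s - 1) < exp \<tau> \<and> exp \<tau> < 1 + m * exp s}"
      using add_strict_mono[of 1 "exp s" 0] by (auto simp: log_region_def)
    moreover have "emeasure lborel \<dots> = ennreal (ln (1 + m * exp s) - ln (m * (exp s - 1)))"
      using \<open>exp s > 1\<close> assms by (intro emeasure_exp_between) (auto simp: algebra_simps)
    \<comment> \<open>The factor \<open>m * exp s\<close> is split off from both ends of the slice
      and cancels in the difference of logarithms. This is what replaces \<open>ln m\<close> by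
      \<open>- ln m\<close>.\<close>
    moreover have "ln (1 + m * exp s) = ln (m * exp s) + ln (1 + exp (- ln m - s))"
      using assms by (subst ln_mult_pos[symmetric]) (auto simp: algebra_simps exp_diff exp_minus intro: add_pos_pos)
    moreover have "ln (m * (exp s - 1)) = ln (m * exp s) + ln (1 - exp (- s))"
    proof -
      have "m * (exp s - 1) = m * exp s * (1 - exp (- s))" by (simp add: exp_minus field_simps)
      moreover have "0 < m * exp s" "0 < 1 - exp (- s)" using assms that by auto
      ultimately show ?thesis by (simp only: ln_mult_pos)
    qed
    moreover have "0 \<le> ln (1 + exp (- ln m - s))" "0 \<le> - ln (1 - exp (- s))" using that by auto
    ultimately show ?thesis using that by (simp flip: ennreal_plus)
  qed
  have int: "(\<integral>\<^sup>+s. ?h l s \<partial>lborel) = (\<integral>\<^sup>+s. ?k l s * ?I s \<partial>lborel) + ennreal (pi\<^sup>2 / 6)" for l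
    by (subst nn_integral_add) (simp_all add: nn_integral_ln_one_minus_exp)
  have "emeasure lborel (log_region m) = emeasure (lborel \<Otimes>\<^sub>M lborel) (log_region m)"
    by (simp add: lborel_prod)
  also have "\<dots> = (\<integral>\<^sup>+s. emeasure lborel (Pair s -` log_region m) \<partial>lborel)"
    by (intro lborel.emeasure_pair_measure_alt) (unfold lborel_prod, simp)
  \<comment> \<open>Each summand vanishes on the half-line that belongs to the other, and
    \<open>s = 0\<close> is a null set.\<close>
  also have "\<dots> = (\<integral>\<^sup>+s. ?h (ln m) (0 + (-1) * s) + ?h (- ln m) s \<partial>lborel)"
    by (rule nn_integral_cong_AE, use AE_lborel_singleton[of "0::real"] in eventually_elim)
       (metis (no_types, lifting) ls gs linorder_neqE_linordered_idom add.right_neutral add.left_neutral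
         greaterThan_iff indicator_simps(2) mult_zero_right mult_minus1 neg_less_0_iff_less not_less_iff_gr_or_eq)
  also have "\<dots> = (\<integral>\<^sup>+s. ?h (ln m) (0 + (-1) * s) \<partial>lborel) + (\<integral>\<^sup>+s. ?h (- ln m) s \<partial>lborel)"
    by (intro nn_integral_add) measurable
  also have "(\<integral>\<^sup>+s. ?h (ln m) (0 + (-1) * s) \<partial>lborel) = (\<integral>\<^sup>+s. ?h (ln m) s \<partial>lborel)"
    by (subst nn_integral_real_affine[of "?h (ln m)" "-1" 0]) auto
  also have "\<dots> + (\<integral>\<^sup>+s. ?h (- ln m) s \<partial>lborel)
      = ((\<integral>\<^sup>+s. ?k (ln m) s * ?I s \<partial>lborel) + (\<integral>\<^sup>+s. ?k (- ln m) s * ?I s \<partial>lborel)) + (ennreal (pi\<^sup>2 / 6) + ennreal (pi\<^sup>2 / 6))"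
    unfolding int by (simp only: ac_simps)
  also have "\<dots> = ennreal (pi\<^sup>2 / 6 + (ln m)\<^sup>2 / 2) + (ennreal (pi\<^sup>2 / 6) + ennreal (pi\<^sup>2 / 6))"
    by (simp only: nn_integral_ln_one_plus_exp_shift)
  also have "\<dots> = ennreal ((pi\<^sup>2 + (ln m)\<^sup>2) / 2)"
    by (simp add: field_simps flip: ennreal_plus)
  finally show ?thesis .
qed

section \<open>Polar of a hexagon\<close>

definition cross2 :: "real^2 \<Rightarrow> real^2 \<Rightarrow> real" where
  "cross2 a b = a $ 1 * b $ 2 - a $ 2 * b $ 1"

lemma cross2_linear [simp]:
  "cross2 (a + b) c = cross2 a c + cross2 b c" "cross2 (a - b) c = cross2 a c - cross2 b c"
  "cross2 (k *\<^sub>R a) c = k * cross2 a c" "cross2 a (b + c) = cross2 a b + cross2 a c"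
  "cross2 a (b - c) = cross2 a b - cross2 a c" "cross2 a (k *\<^sub>R c) = k * cross2 a c"
  "cross2 a a = 0" "cross2 0 a = 0" "cross2 a 0 = 0" "cross2 (- a) b = - cross2 a b" "cross2 a (- b) = - cross2 a b"
  by (simp_all add: cross2_def algebra_simps)

lemma cross2_skew: "cross2 b a = - cross2 a b"
  by (simp add: cross2_def)

text \<open>Cramer's rule in the plane, cleared of its denominator.\<close>

lemma cross2_expand:
  "cross2 a b *\<^sub>R x = cross2 x b *\<^sub>R a + cross2 a x *\<^sub>R b"
  by (simp add: cross2_def vec_eq_iff forall_2 algebra_simps)

lemma inner_vec2: "x \<bullet> y = x $ 1 * y $ 1 + x $ 2 * y $ 2" for x y :: "real^2"
  by (simp add: inner_vec_def sum_2)

text \<open>The dual unit ball in coordinates with respect to the covectors \<open>beta1 P\<close>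
  and \<open>beta2 P\<close> below. The set is the same at every point; only the covectors
  vary.\<close>

definition hexagon :: "(real^2) set" where
  "hexagon = {h. \<bar>h $ 1\<bar> \<le> 1 \<and> \<bar>h $ 2\<bar> \<le> 1 \<and> \<bar>h $ 1 + h $ 2\<bar> \<le> 1}"

section \<open>Lebesgue measure on \<open>real^2\<close> as a product measure\<close>

definition vec2 :: "real \<times> real \<Rightarrow> real^2" where
  "vec2 z = vector [fst z, snd z]"

lemma vec2_nth [simp]: "vec2 z $ 1 = fst z" "vec2 z $ 2 = snd z"
  by (simp_all add: vec2_def)

lemma continuous_on_vec2 [continuous_intros]: "continuous_on S vec2"
proof -
  have *: "vec2 = (\<lambda>z. \<chi> i. if i = 1 then fst z else snd z)"
    by (auto simp: fun_eq_iff vec_eq_iff forall_2)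
  have "continuous_on S (\<lambda>z. if i = 1 then fst z else snd z)" for i :: 2
    by (cases "i = 1") (auto intro!: continuous_intros)
  then show ?thesis unfolding * by (intro continuous_on_vec_lambda)
qed

lemma vec2_measurable [measurable]: "vec2 \<in> borel_measurable borel"
  by (intro borel_measurable_continuous_onI continuous_intros)

text \<open>Areas are stated on \<open>real^2\<close>, while slicing takes place on pairs of reals.
  The identification by coordinates preserves the measure of boxes, which determines the
  measure.\<close>

lemma lborel_vec2: "(lborel :: (real^2) measure) = distr lborel borel vec2"
proof (rule lborel_eqI)
  fix l u :: "real^2"
  assume le: "\<And>b. b \<in> Basis \<Longrightarrow> l \<bullet> b \<le> u \<bullet> b"
  have B: "Basis = {axis 1 1, axis 2 1 :: real^2}"
    by (auto simp: Basis_vec_def UNIV_2)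
  have ne: "(axis 1 1 :: real^2) \<noteq> axis 2 1" by (simp add: axis_eq_axis)
  have "vec2 -` box l u = {l$1<..<u$1} \<times> {l$2<..<u$2}"
    by (auto simp: mem_box_cart forall_2)
  then have "emeasure (distr lborel borel vec2) (box l u) = emeasure lborel ({l$1<..<u$1} \<times> {l$2<..<u$2})"
    by (simp add: emeasure_distr)
  also have "\<dots> = emeasure lborel {l$1<..<u$1} * emeasure lborel {l$2<..<u$2}"
    by (simp flip: lborel_prod add: lborel.emeasure_pair_measure_Times)
  also have "\<dots> = ennreal ((u$1 - l$1) * (u$2 - l$2))"
    using le[of "axis 1 1"] le[of "axis 2 1"] unfolding B by (simp add: inner_axis ennreal_mult)
  also have "(u$1 - l$1) * (u$2 - l$2) = (\<Prod>b\<in>Basis. (u - l) \<bullet> b)"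
    unfolding B using ne by (simp add: inner_axis)
  finally show "emeasure (distr lborel borel vec2) (box l u) = (\<Prod>b\<in>Basis. (u - l) \<bullet> b)" .
qed simp

lemma hexagon_closed: "closed hexagon"
  unfolding hexagon_def by (intro closed_Collect_conj closed_Collect_le continuous_intros)

lemma emeasure_hexagon: "emeasure lborel hexagon = 3"
proof -
  let ?H = "vec2 -` hexagon"
  have H: "?H \<in> sets borel"
    using measurable_sets[OF vec2_measurable, of hexagon] hexagon_closed by simp
  have "emeasure lborel hexagon = emeasure (lborel \<Otimes>\<^sub>M lborel) ?H"
    by (subst lborel_vec2) (simp add: emeasure_distr hexagon_closed lborel_prod)
  also have "\<dots> = (\<integral>\<^sup>+c. emeasure lborel (Pair c -` ?H) \<partial>lborel)"
    using H by (intro lborel.emeasure_pair_measure_alt) (unfold lborel_prod, simp)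
  also have "\<dots> = (\<integral>\<^sup>+c. ennreal (2 - \<bar>c\<bar>) * indicator {-1..1} c \<partial>lborel)"
  proof (rule nn_integral_cong)
    fix c :: real
    show "emeasure lborel (Pair c -` ?H) = ennreal (2 - \<bar>c\<bar>) * indicator {-1..1} c"
    proof (cases "\<bar>c\<bar> \<le> 1")
      case True
      then have "Pair c -` ?H = (if c \<ge> 0 then {-1..1 - c} else {-1 - c..1})"
        by (auto simp: hexagon_def abs_le_iff)
      then show ?thesis using True by (auto simp: abs_le_iff)
    next
      case False
      then have "Pair c -` ?H = {}" by (auto simp: hexagon_def)
      then show ?thesis using False by (auto simp: indicator_def)
    qed
  qed
  also have "\<dots> = (\<integral>\<^sup>+c. ennreal (2 + c) * indicator {-1..0} c + ennreal (2 - c) * indicator {0..1} c \<partial>lborel)"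
    by (rule nn_integral_cong_AE, use AE_lborel_singleton[of "0::real"] in eventually_elim)
       (auto simp: indicator_def)
  also have "\<dots> = (\<integral>\<^sup>+c. ennreal (2 + c) * indicator {-1..0} c \<partial>lborel) + (\<integral>\<^sup>+c. ennreal (2 - c) * indicator {0..1} c \<partial>lborel)"
    by (intro nn_integral_add) measurable
  also have "(\<integral>\<^sup>+c. ennreal (2 + c) * indicator {-1..0} c \<partial>lborel) = ennreal ((2 * 0 + 0\<^sup>2 / 2) - (2 * (-1) + (-1)\<^sup>2 / 2))"
    by (rule nn_integral_FTC_Icc) (auto intro!: derivative_eq_intros)
  also have "(\<integral>\<^sup>+c. ennreal (2 - c) * indicator {0..1} c \<partial>lborel) = ennreal ((2 * 1 - 1\<^sup>2 / 2) - (2 * 0 - 0\<^sup>2 / 2))"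
    by (rule nn_integral_FTC_Icc) (auto intro!: derivative_eq_intros)
  finally show ?thesis by (simp flip: ennreal_plus)
qed

text \<open>The vertices of \<open>{\<xi>. |s| \<le> 1, |t| \<le> 1, |s - t| \<le> 1}\<close> in the coordinates \<open>s = \<beta>1 \<bullet> \<xi>\<close>,
  \<open>t = \<beta>2 \<bullet> \<xi>\<close> are \<open>\<plusminus>(1,0)\<close>, \<open>\<plusminus>(0,1)\<close>, \<open>\<plusminus>(1,1)\<close>, which gives the three conditions of \<open>hexagon\<close>.\<close>

lemma polar_hexagon:
  fixes \<beta>1 \<beta>2 :: "real^2"
  assumes "cross2 \<beta>1 \<beta>2 \<noteq> 0"
  shows "{\<eta>. \<forall>\<xi>\<in>{\<xi>. \<bar>\<beta>1 \<bullet> \<xi>\<bar> \<le> 1 \<and> \<bar>\<beta>2 \<bullet> \<xi>\<bar> \<le> 1 \<and> \<bar>\<beta>1 \<bullet> \<xi> - \<beta>2 \<bullet> \<xi>\<bar> \<le> 1}. \<eta> \<bullet> \<xi> \<le> 1}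
    = (\<lambda>h. h $ 1 *\<^sub>R \<beta>1 + h $ 2 *\<^sub>R \<beta>2) ` hexagon" (is "?P = ?f ` _")
proof (intro set_eqI iffI)
  fix \<eta> assume "\<eta> \<in> ?f ` hexagon"
  then obtain h where h: "h \<in> hexagon" and \<eta>: "\<eta> = ?f h" by auto
  have "c * s + d * t \<le> 1" if "\<bar>c\<bar> \<le> 1" "\<bar>d\<bar> \<le> 1" "\<bar>c + d\<bar> \<le> 1" "\<bar>s\<bar> \<le> 1" "\<bar>t\<bar> \<le> 1" "\<bar>s - t\<bar> \<le> 1" for c d s t :: real
  proof -
    have m: "x * y \<le> \<bar>y\<bar>" if "\<bar>x\<bar> \<le> 1" for x y :: real
      using mult_right_mono[OF that, of "\<bar>y\<bar>"] abs_ge_self[of "x * y"] by (simp add: abs_mult)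
    have *: "c * s + d * t = c * (s - t) + (c + d) * t" "c * s + d * t = d * (t - s) + (c + d) * s"
      by (simp_all add: algebra_simps)
    \<comment> \<open>In each sector the pairing is written in two of the quantities
      \<open>s\<close>, \<open>t\<close>, \<open>s - t\<close>, chosen so that their absolute values
      add up to the third one and hence to at most 1.\<close>
    consider "s * t \<le> 0" | "s * t > 0" "\<bar>t\<bar> \<le> \<bar>s\<bar>" | "s * t > 0" "\<bar>s\<bar> \<le> \<bar>t\<bar>" by linarith
    then show ?thesis
    proof cases
      case 1
      then have "\<bar>s\<bar> + \<bar>t\<bar> \<le> 1" using that by (auto simp: mult_le_0_iff)
      then show ?thesis using m[of c s] m[of d t] that by linarith
    next
      case 2
      then have "\<bar>s - t\<bar> + \<bar>t\<bar> \<le> 1" using that by (auto simp: zero_less_mult_iff)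
      then show ?thesis using m[of c "s - t"] m[of "c + d" t] that * by linarith
    next
      case 3
      then have "\<bar>t - s\<bar> + \<bar>s\<bar> \<le> 1" using that by (auto simp: zero_less_mult_iff)
      then show ?thesis using m[of d "t - s"] m[of "c + d" s] that * by linarith
    qed
  qed
  then show "\<eta> \<in> ?P" using h by (auto simp: \<eta> hexagon_def inner_add_left)
next
  fix \<eta> assume \<eta>: "\<eta> \<in> ?P"
  let ?D = "cross2 \<beta>1 \<beta>2"
  define h :: "real^2" where "h = vector [cross2 \<eta> \<beta>2 / ?D, cross2 \<beta>1 \<eta> / ?D]"
  have "\<eta> = (1 / ?D) *\<^sub>R (?D *\<^sub>R \<eta>)" using assms by simp
  also have "\<dots> = ?f h" by (subst cross2_expand) (simp add: h_def scaleR_add_right)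
  finally have f: "\<eta> = ?f h" .
  \<comment> \<open>\<open>X s t\<close> is the vector on which \<open>\<beta>1\<close> and
    \<open>\<beta>2\<close> take the values \<open>s\<close> and \<open>t\<close>, again by Cramer's
    rule. It realises the vertices against which \<open>\<eta>\<close> is tested.\<close>
  define X :: "real \<Rightarrow> real \<Rightarrow> real^2" where
    "X s t = (1 / ?D) *\<^sub>R vector [s * \<beta>2 $ 2 - t * \<beta>1 $ 2, t * \<beta>1 $ 1 - s * \<beta>2 $ 1]" for s t
  have X: "\<beta>1 \<bullet> X s t = s" "\<beta>2 \<bullet> X s t = t" for s t
  proof -
    have "\<beta>1 \<bullet> vector [s * \<beta>2 $ 2 - t * \<beta>1 $ 2, t * \<beta>1 $ 1 - s * \<beta>2 $ 1] = s * ?D"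
      "\<beta>2 \<bullet> vector [s * \<beta>2 $ 2 - t * \<beta>1 $ 2, t * \<beta>1 $ 1 - s * \<beta>2 $ 1] = t * ?D"
      by (simp_all add: inner_vec2 cross2_def algebra_simps)
    then show "\<beta>1 \<bullet> X s t = s" "\<beta>2 \<bullet> X s t = t"
      unfolding X_def inner_scaleR_right using assms by simp_all
  qed
  have "h $ 1 * s + h $ 2 * t \<le> 1" if "\<bar>s\<bar> \<le> 1" "\<bar>t\<bar> \<le> 1" "\<bar>s - t\<bar> \<le> 1" for s t
  proof -
    have "\<eta> \<bullet> X s t \<le> 1" using \<eta> that by (simp add: X)
    then show ?thesis unfolding f by (simp add: inner_add_left X)
  qed
  from this[of 1 0] this[of "-1" 0] this[of 0 1] this[of 0 "-1"] this[of 1 1] this[of "-1" "-1"]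
  have "h \<in> hexagon" by (auto simp: hexagon_def)
  with f show "\<eta> \<in> ?f ` hexagon" by blast
qed

lemma emeasure_polar_hexagon:
  fixes \<beta>1 \<beta>2 :: "real^2"
  assumes "cross2 \<beta>1 \<beta>2 \<noteq> 0"
  shows "emeasure lborel ((\<lambda>h. h $ 1 *\<^sub>R \<beta>1 + h $ 2 *\<^sub>R \<beta>2) ` hexagon) = ennreal (3 * \<bar>cross2 \<beta>1 \<beta>2\<bar>)"
    (is "emeasure _ (?f ` _) = _")
proof -
  have lin: "linear ?f" by (auto intro!: linearI simp: algebra_simps)
  have H: "hexagon \<in> lmeasurable"
    using emeasure_hexagon hexagon_closed by (intro fmeasurableI) auto
  have M: "measure lebesgue hexagon = 3"
    using emeasure_hexagon hexagon_closed by (simp add: measure_def)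
  \<comment> \<open>Compactness makes the image closed, hence Borel, so the linear change of
    variables for Lebesgue measure also gives the value for \<open>lborel\<close>.\<close>
  have "hexagon \<subseteq> cbox (vector [-1, -1]) (vector [1, 1])"
    by (auto simp: hexagon_def mem_box_cart forall_2)
  then have "compact hexagon"
    using hexagon_closed bounded_subset[OF bounded_cbox] by (auto simp: compact_eq_bounded_closed)
  then have cl: "closed (?f ` hexagon)"
    by (intro compact_imp_closed compact_continuous_image continuous_intros)
  have "det (matrix ?f) = cross2 \<beta>1 \<beta>2"
    by (simp add: det_2 matrix_def cross2_def axis_def)
  then have "measure lebesgue (?f ` hexagon) = 3 * \<bar>cross2 \<beta>1 \<beta>2\<bar>"
    using measure_linear_image[OF lin H] M by simp
  moreover have "emeasure lebesgue (?f ` hexagon) = ennreal (measure lebesgue (?f ` hexagon))"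
    using measurable_linear_image[OF lin H] by (simp add: emeasure_eq_measure2)
  ultimately show ?thesis using cl by simp
qed

section \<open>Hilbert metric of a triangle\<close>

locale triangle =
  fixes u v w :: "real^2"
  assumes nondegenerate: "cross2 (u - w) (v - w) \<noteq> 0"
begin

definition D :: real where "D = cross2 (u - w) (v - w)"

text \<open>Barycentric coordinates with weights on \<open>u\<close>, \<open>v\<close>,
  \<open>w\<close>: the first two by Cramer's rule, the third as the complement to 1.\<close>

definition lam1 where "lam1 P = cross2 (P - w) (v - w) / D"
definition lam2 where "lam2 P = cross2 (u - w) (P - w) / D"
definition lam3 where "lam3 P = 1 - lam1 P - lam2 P"

lemma D_nz: "D \<noteq> 0"
  using nondegenerate by (simp add: D_def)

lemma barycentric_expand: "P = lam1 P *\<^sub>R u + lam2 P *\<^sub>R v + lam3 P *\<^sub>R w"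
proof -
  have "P - w = (1 / D) *\<^sub>R (D *\<^sub>R (P - w))" using D_nz by simp
  also have "\<dots> = lam1 P *\<^sub>R (u - w) + lam2 P *\<^sub>R (v - w)"
    unfolding D_def by (subst cross2_expand) (simp add: lam1_def lam2_def D_def scaleR_add_right)
  finally show ?thesis by (simp add: lam3_def algebra_simps)
qed

lemma lam_sum: "lam1 P + lam2 P + lam3 P = 1"
  by (simp add: lam3_def)

lemma lam_point:
  assumes "x + y + z = 1"
  shows "lam1 (x *\<^sub>R u + y *\<^sub>R v + z *\<^sub>R w) = x" "lam2 (x *\<^sub>R u + y *\<^sub>R v + z *\<^sub>R w) = y"
    "lam3 (x *\<^sub>R u + y *\<^sub>R v + z *\<^sub>R w) = z"
proof -
  have z: "z = 1 - x - y" using assms by simp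
  have "x *\<^sub>R u + y *\<^sub>R v + z *\<^sub>R w - w = x *\<^sub>R (u - w) + y *\<^sub>R (v - w)"
    by (simp add: z algebra_simps)
  then show "lam1 (x *\<^sub>R u + y *\<^sub>R v + z *\<^sub>R w) = x" "lam2 (x *\<^sub>R u + y *\<^sub>R v + z *\<^sub>R w) = y"
    unfolding lam1_def lam2_def
    by (simp_all only: cross2_linear(1,3,4,6,7) D_def[symmetric] mult_zero_right add_0 add_0_right nonzero_mult_div_cancel_right[OF D_nz])
  then show "lam3 (x *\<^sub>R u + y *\<^sub>R v + z *\<^sub>R w) = z"
    by (simp add: lam3_def z)
qed

lemma lam_inj: "lam1 P = lam1 Q \<Longrightarrow> lam2 P = lam2 Q \<Longrightarrow> P = Q"
  by (metis barycentric_expand lam3_def)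

lemma not_collinear: "\<not> collinear {u, v, w}"
proof
  assume "collinear {u, v, w}"
  then consider "u = w" | c where "v = c *\<^sub>R u + (1 - c) *\<^sub>R w"
    by (auto simp: collinear_3_expand)
  then have "cross2 (u - w) (v - w) = 0"
  proof cases
    case (2 c)
    then have "v - w = c *\<^sub>R (u - w)" by (simp add: algebra_simps)
    then show ?thesis by (simp only: cross2_linear(6,7) mult_zero_right)
  qed simp
  with nondegenerate show False by simp
qed

lemma hull_eq: "convex hull {u, v, w} = {P. lam1 P \<ge> 0 \<and> lam2 P \<ge> 0 \<and> lam3 P \<ge> 0}"
proof (intro set_eqI iffI)
  fix P assume "P \<in> convex hull {u, v, w}"
  then show "P \<in> {P. lam1 P \<ge> 0 \<and> lam2 P \<ge> 0 \<and> lam3 P \<ge> 0}"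
    unfolding convex_hull_3 by (auto simp: lam_point)
next
  fix P assume "P \<in> {P. lam1 P \<ge> 0 \<and> lam2 P \<ge> 0 \<and> lam3 P \<ge> 0}"
  then show "P \<in> convex hull {u, v, w}"
    unfolding convex_hull_3 using barycentric_expand[of P] lam_sum[of P] by blast
qed

definition Omega :: "(real^2) set" where
  "Omega = interior (convex hull {u, v, w})"

lemma Omega_eq: "Omega = {P. lam1 P > 0 \<and> lam2 P > 0 \<and> lam3 P > 0}"
proof -
  have eq: "Omega = {P. \<exists>x y z. 0 < x \<and> 0 < y \<and> 0 < z \<and> x + y + z = 1 \<and> x *\<^sub>R u + y *\<^sub>R v + z *\<^sub>R w = P}"
    unfolding Omega_def by (intro interior_convex_hull_3_minimal not_collinear) simp
  show ?thesis
  proof (intro set_eqI iffI)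
    fix P assume "P \<in> Omega"
    then show "P \<in> {P. lam1 P > 0 \<and> lam2 P > 0 \<and> lam3 P > 0}"
      unfolding eq by (auto simp: lam_point)
  next
    fix P assume "P \<in> {P. lam1 P > 0 \<and> lam2 P > 0 \<and> lam3 P > 0}"
    then show "P \<in> Omega"
      unfolding eq using barycentric_expand[of P, symmetric] lam_sum[of P] by blast
  qed
qed

lemma frontier_Omega:
  "frontier Omega = {P. lam1 P \<ge> 0 \<and> lam2 P \<ge> 0 \<and> lam3 P \<ge> 0 \<and> (lam1 P = 0 \<or> lam2 P = 0 \<or> lam3 P = 0)}"
proof -
  \<comment> \<open>The barycentre shows that the interior is nonempty, so the closure of the
    interior of the convex hull is the closed triangle.\<close>
  have "(1/3) *\<^sub>R u + (1/3) *\<^sub>R v + (1/3) *\<^sub>R w \<in> Omega"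
    unfolding Omega_eq by (simp add: lam_point)
  then have "closure Omega = closure (convex hull {u, v, w})"
    unfolding Omega_def by (intro convex_closure_interior) (auto simp: convex_convex_hull)
  also have "\<dots> = convex hull {u, v, w}"
    by (intro closure_closed compact_imp_closed finite_imp_compact_convex_hull) simp
  finally have f: "frontier Omega = convex hull {u, v, w} - Omega"
    by (simp add: frontier_def) (simp add: Omega_def)
  have *: "(a \<ge> 0 \<and> b \<ge> 0 \<and> c \<ge> 0) \<and> \<not> (a > 0 \<and> b > 0 \<and> c > 0) \<longleftrightarrow>
      a \<ge> 0 \<and> b \<ge> 0 \<and> c \<ge> 0 \<and> (a = 0 \<or> b = 0 \<or> c = 0)" for a b c :: real
    by auto
  show ?thesis
    unfolding f by (rule set_eqI) (simp only: hull_eq Omega_eq Diff_iff mem_Collect_eq *)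
qed

section \<open>The Hilbert norm and the dual unit ball\<close>

definition cov1 :: "real^2" where "cov1 = (1 / D) *\<^sub>R vector [(v - w) $ 2, - ((v - w) $ 1)]"
definition cov2 :: "real^2" where "cov2 = (1 / D) *\<^sub>R vector [- ((u - w) $ 2), (u - w) $ 1]"
definition cov3 :: "real^2" where "cov3 = - cov1 - cov2"

lemma cov_inner: "cov1 \<bullet> \<xi> = cross2 \<xi> (v - w) / D" "cov2 \<bullet> \<xi> = cross2 (u - w) \<xi> / D"
  by (simp_all add: cov1_def cov2_def inner_vec2 cross2_def divide_inverse algebra_simps)

text \<open>The covectors are the differentials of the affine functions \<open>lam1\<close>,
  \<open>lam2\<close>, \<open>lam3\<close>. They add up to zero because the coordinates add up to
  1.\<close>

lemma lam_move:
  "lam1 (P + \<xi>) = lam1 P + cov1 \<bullet> \<xi>" "lam2 (P + \<xi>) = lam2 P + cov2 \<bullet> \<xi>" "lam3 (P + \<xi>) = lam3 P + cov3 \<bullet> \<xi>"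
proof -
  have e: "P + \<xi> - w = (P - w) + \<xi>" by simp
  show 1: "lam1 (P + \<xi>) = lam1 P + cov1 \<bullet> \<xi>" "lam2 (P + \<xi>) = lam2 P + cov2 \<bullet> \<xi>"
    unfolding lam1_def lam2_def cov_inner e cross2_linear(1,4) by (simp_all only: add_divide_distrib)
  show "lam3 (P + \<xi>) = lam3 P + cov3 \<bullet> \<xi>"
    by (simp add: lam3_def cov3_def 1 inner_diff_left)
qed

lemma cov_zero_imp: "cov1 \<bullet> \<xi> = 0 \<Longrightarrow> cov2 \<bullet> \<xi> = 0 \<Longrightarrow> \<xi> = 0"
  using lam_inj[of "0 + \<xi>" 0] by (simp only: lam_move) simp

lemma cross2_cov: "cross2 cov1 cov2 = 1 / D"
proof -
  have "cross2 cov1 cov2 = (1 / D) * (1 / D) * cross2 (u - w) (v - w)"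
    unfolding cov1_def cov2_def cross2_linear(3,6) by (simp add: cross2_def algebra_simps)
  then show ?thesis using D_nz by (simp add: D_def)
qed

text \<open>The differentials of the logarithms of the barycentric coordinates.\<close>

definition rate1 where "rate1 P = (1 / lam1 P) *\<^sub>R cov1"
definition rate2 where "rate2 P = (1 / lam2 P) *\<^sub>R cov2"
definition rate3 where "rate3 P = (1 / lam3 P) *\<^sub>R cov3"

text \<open>At the point \<open>P + (1 / \<sigma>) *\<^sub>R \<xi>\<close> each barycentric
  coordinate is a positive multiple of \<open>\<sigma>\<close> plus the corresponding rate. The
  boundary is met when the smallest of these sums is zero, that is, when \<open>\<sigma>\<close> is
  the largest negated rate.\<close>

lemma sigma_plus_Omega:
  assumes P: "P \<in> Omega" and "\<xi> \<noteq> 0"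
  shows "sigma_plus Omega P \<xi> = max (max (- (rate1 P \<bullet> \<xi>)) (- (rate2 P \<bullet> \<xi>))) (- (rate3 P \<bullet> \<xi>))" (is "_ = ?S")
proof -
  let ?a = "rate1 P \<bullet> \<xi>" and ?b = "rate2 P \<bullet> \<xi>" and ?c = "rate3 P \<bullet> \<xi>"
  have pos: "lam1 P > 0" "lam2 P > 0" "lam3 P > 0" using P by (auto simp: Omega_eq)
  have cov: "cov1 \<bullet> \<xi> = lam1 P * ?a" "cov2 \<bullet> \<xi> = lam2 P * ?b" "cov3 \<bullet> \<xi> = lam3 P * ?c"
    using pos by (simp_all add: rate1_def rate2_def rate3_def)
  \<comment> \<open>Otherwise all rates are nonnegative. Weighted by the barycentric coordinates
    they add up to zero, so all vanish and \<open>\<xi> = 0\<close>.\<close>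
  have "?S > 0"
  proof (rule ccontr)
    assume "\<not> ?thesis"
    then have ge: "?a \<ge> 0" "?b \<ge> 0" "?c \<ge> 0" by auto
    have "lam1 P * ?a + lam2 P * ?b + lam3 P * ?c = 0"
      unfolding cov[symmetric] by (simp add: cov3_def inner_diff_left)
    moreover have "lam1 P * ?a \<ge> 0" "lam2 P * ?b \<ge> 0" "lam3 P * ?c \<ge> 0" using ge pos by simp_all
    ultimately have "lam1 P * ?a = 0" "lam2 P * ?b = 0" by linarith+
    then have "\<xi> = 0" by (intro cov_zero_imp) (simp_all only: cov)
    with assms show False by simp
  qed
  have iff: "(\<exists>V\<in>frontier Omega. \<xi> = \<sigma> *\<^sub>R (V - P)) \<longleftrightarrow> \<sigma> = ?S" if "\<sigma> > 0" for \<sigma>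
  proof -
    let ?V = "P + (1 / \<sigma>) *\<^sub>R \<xi>"
    have "\<xi> = \<sigma> *\<^sub>R (V - P) \<longleftrightarrow> V = ?V" for V
    proof
      assume "\<xi> = \<sigma> *\<^sub>R (V - P)"
      then show "V = ?V" using that by simp
    next
      assume "V = ?V" then show "\<xi> = \<sigma> *\<^sub>R (V - P)" using that by simp
    qed
    then have "(\<exists>V\<in>frontier Omega. \<xi> = \<sigma> *\<^sub>R (V - P)) \<longleftrightarrow> ?V \<in> frontier Omega" by auto
    moreover have l: "lam1 ?V = lam1 P / \<sigma> * (\<sigma> + ?a)" "lam2 ?V = lam2 P / \<sigma> * (\<sigma> + ?b)" "lam3 ?V = lam3 P / \<sigma> * (\<sigma> + ?c)"
      unfolding lam_move inner_scaleR_right cov using that by (simp_all add: field_simps)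
    moreover have "(lam1 ?V \<ge> 0 \<longleftrightarrow> \<sigma> \<ge> - ?a) \<and> (lam2 ?V \<ge> 0 \<longleftrightarrow> \<sigma> \<ge> - ?b) \<and> (lam3 ?V \<ge> 0 \<longleftrightarrow> \<sigma> \<ge> - ?c)"
      unfolding l using pos that by (auto simp: zero_le_mult_iff zero_le_divide_iff divide_le_0_iff)
    moreover have "(lam1 ?V = 0 \<longleftrightarrow> \<sigma> = - ?a) \<and> (lam2 ?V = 0 \<longleftrightarrow> \<sigma> = - ?b) \<and> (lam3 ?V = 0 \<longleftrightarrow> \<sigma> = - ?c)"
      unfolding l using pos that by auto
    ultimately show ?thesis unfolding frontier_Omega mem_Collect_eq
      by (simp add: max_def) (smt (verit))
  qed
  show ?thesis
    unfolding sigma_plus_def using \<open>?S > 0\<close> iff by (intro the_equality) auto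
qed

lemma sigma_minus_eq: "sigma_minus \<Omega> P \<xi> = sigma_plus \<Omega> P (- \<xi>)"
proof -
  have "\<xi> = \<sigma> *\<^sub>R (P - V) \<longleftrightarrow> - \<xi> = \<sigma> *\<^sub>R (V - P)" for \<sigma> V
  proof -
    have "\<sigma> *\<^sub>R (V - P) = - (\<sigma> *\<^sub>R (P - V))" by (simp add: scaleR_diff_right)
    then show ?thesis by (simp only: neg_equal_iff_equal)
  qed
  then show ?thesis unfolding sigma_minus_def sigma_plus_def by (simp only:)
qed

text \<open>Half the differentials of the logarithms of \<open>lam1 / lam3\<close> and
  \<open>lam2 / lam3\<close>, the homogeneous coordinates used by \<open>log_chart\<close>.\<close>

definition beta1 where "beta1 P = (1 / 2) *\<^sub>R (rate1 P - rate3 P)"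
definition beta2 where "beta2 P = (1 / 2) *\<^sub>R (rate2 P - rate3 P)"

text \<open>The Hilbert norm is half the difference between the largest and the smallest of the
  three rates, hence half the largest modulus of a pairwise difference.\<close>

lemma unit_ball_Omega:
  assumes P: "P \<in> Omega"
  shows "unit_ball Omega P = {\<xi>. \<bar>beta1 P \<bullet> \<xi>\<bar> \<le> 1 \<and> \<bar>beta2 P \<bullet> \<xi>\<bar> \<le> 1 \<and> \<bar>beta1 P \<bullet> \<xi> - beta2 P \<bullet> \<xi>\<bar> \<le> 1}"
proof -
  have "hilbert_norm Omega P \<xi> \<le> 1 \<longleftrightarrow> \<bar>beta1 P \<bullet> \<xi>\<bar> \<le> 1 \<and> \<bar>beta2 P \<bullet> \<xi>\<bar> \<le> 1 \<and> \<bar>beta1 P \<bullet> \<xi> - beta2 P \<bullet> \<xi>\<bar> \<le> 1" for \<xi>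
  proof (cases "\<xi> = 0")
    case False
    have b: "beta1 P \<bullet> \<xi> = (rate1 P \<bullet> \<xi> - rate3 P \<bullet> \<xi>) / 2" "beta2 P \<bullet> \<xi> = (rate2 P \<bullet> \<xi> - rate3 P \<bullet> \<xi>) / 2"
      by (simp_all add: beta1_def beta2_def inner_diff_left)
    have n: "hilbert_norm Omega P \<xi> =
        (max (max (- (rate1 P \<bullet> \<xi>)) (- (rate2 P \<bullet> \<xi>))) (- (rate3 P \<bullet> \<xi>))
         + max (max (rate1 P \<bullet> \<xi>) (rate2 P \<bullet> \<xi>)) (rate3 P \<bullet> \<xi>)) / 2"
      using False sigma_plus_Omega[OF P, of \<xi>] sigma_plus_Omega[OF P, of "- \<xi>"]
      by (simp add: hilbert_norm_def sigma_minus_eq)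
    have "(max (max (- a) (- b)) (- c) + max (max a b) c) / 2 \<le> 1 \<longleftrightarrow>
        \<bar>(a - c) / 2\<bar> \<le> 1 \<and> \<bar>(b - c) / 2\<bar> \<le> 1 \<and> \<bar>(a - c) / 2 - (b - c) / 2\<bar> \<le> 1" for a b c :: real
      unfolding diff_divide_distrib[symmetric] by (simp add: max_def abs_le_iff) linarith
    then show ?thesis unfolding n b .
  qed (simp add: hilbert_norm_def)
  then show ?thesis by (auto simp: unit_ball_def)
qed

lemma cross2_beta:
  assumes P: "P \<in> Omega"
  shows "cross2 (beta1 P) (beta2 P) = 1 / (4 * D * lam1 P * lam2 P * lam3 P)"
proof -
  have pos: "lam1 P > 0" "lam2 P > 0" "lam3 P > 0" using P by (auto simp: Omega_eq)
  \<comment> \<open>Since \<open>cov3 = - cov1 - cov2\<close>, all pairs of covectors have the same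
    cross product up to sign. The remaining sum of reciprocals collapses because the coordinates add
    up to 1.\<close>
  have "cross2 (beta1 P) (beta2 P) = (1 / 4) * ((1 / lam1 P) * (1 / lam2 P) + (1 / lam1 P) * (1 / lam3 P) + (1 / lam2 P) * (1 / lam3 P)) * cross2 cov1 cov2"
    unfolding beta1_def beta2_def rate1_def rate2_def rate3_def cov3_def
    by (simp add: cross2_skew[of cov1 cov2] algebra_simps)
  also have "(1 / lam1 P) * (1 / lam2 P) + (1 / lam1 P) * (1 / lam3 P) + (1 / lam2 P) * (1 / lam3 P) = (lam1 P + lam2 P + lam3 P) / (lam1 P * lam2 P * lam3 P)"
    using pos by (simp add: field_simps)
  finally show ?thesis unfolding cross2_cov lam_sum by simp
qed

lemma emeasure_dual_unit_ball:
  assumes P: "P \<in> Omega"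
  shows "emeasure lborel (dual_unit_ball Omega P) = ennreal (3 * \<bar>cross2 (beta1 P) (beta2 P)\<bar>)"
proof -
  have pos: "lam1 P > 0" "lam2 P > 0" "lam3 P > 0" using P by (auto simp: Omega_eq)
  have nz: "cross2 (beta1 P) (beta2 P) \<noteq> 0"
    unfolding cross2_beta[OF P] using pos D_nz by simp
  show ?thesis
    unfolding dual_unit_ball_def unit_ball_Omega[OF P] polar_hexagon[OF nz] emeasure_polar_hexagon[OF nz] ..
qed

section \<open>The logarithmic chart as a change of variables\<close>

definition log_chart :: "real^2 \<Rightarrow> real^2 \<Rightarrow> real^2" where
  "log_chart c P = vector [ln (lam1 P) - ln (lam3 P), ln (lam2 P) - ln (lam3 P)] - c"

lemma lam_has_derivative:
  "(lam1 has_derivative (\<bullet>) cov1) (at P within S)" "(lam2 has_derivative (\<bullet>) cov2) (at P within S)"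
  "(lam3 has_derivative (\<bullet>) cov3) (at P within S)"
proof -
  have l: "lam1 = (\<lambda>P. lam1 0 + cov1 \<bullet> P)" "lam2 = (\<lambda>P. lam2 0 + cov2 \<bullet> P)" "lam3 = (\<lambda>P. lam3 0 + cov3 \<bullet> P)"
    by (rule ext, rule lam_move[of 0, unfolded add_0])+
  have d: "((\<lambda>P. a + c \<bullet> P) has_derivative (\<bullet>) c) (at P within S)" for a and c :: "real^2"
    by (auto intro!: derivative_eq_intros)
  show "(lam1 has_derivative (\<bullet>) cov1) (at P within S)" by (subst l) (rule d)
  show "(lam2 has_derivative (\<bullet>) cov2) (at P within S)" by (subst l) (rule d)
  show "(lam3 has_derivative (\<bullet>) cov3) (at P within S)" by (subst l) (rule d)
qed

lemma log_chart_has_derivative: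
  assumes "P \<in> Omega"
  shows "(log_chart c has_derivative (\<lambda>\<xi>. vector [2 * (beta1 P \<bullet> \<xi>), 2 * (beta2 P \<bullet> \<xi>)])) (at P within S)"
proof -
  have pos: "lam1 P > 0" "lam2 P > 0" "lam3 P > 0" using assms by (auto simp: Omega_eq)
  have b: "2 * (beta1 P \<bullet> \<xi>) = (cov1 \<bullet> \<xi>) / lam1 P - (cov3 \<bullet> \<xi>) / lam3 P"
    "2 * (beta2 P \<bullet> \<xi>) = (cov2 \<bullet> \<xi>) / lam2 P - (cov3 \<bullet> \<xi>) / lam3 P" for \<xi>
    by (simp_all add: beta1_def beta2_def rate1_def rate2_def rate3_def inner_diff_left right_diff_distrib)
  have d1: "((\<lambda>P. ln (lam1 P) - ln (lam3 P) - c $ 1) has_derivative (\<lambda>\<xi>. 2 * (beta1 P \<bullet> \<xi>))) (at P within S)"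
    unfolding b using pos
    by (auto intro!: derivative_eq_intros lam_has_derivative simp: divide_inverse mult.commute)
  have d2: "((\<lambda>P. ln (lam2 P) - ln (lam3 P) - c $ 2) has_derivative (\<lambda>\<xi>. 2 * (beta2 P \<bullet> \<xi>))) (at P within S)"
    unfolding b using pos
    by (auto intro!: derivative_eq_intros lam_has_derivative simp: divide_inverse mult.commute)
  show ?thesis
  proof (subst has_derivative_componentwise_within, rule ballI)
    fix i :: "real^2" assume "i \<in> Basis"
    then obtain k :: 2 where "i = axis k 1" by (auto simp: Basis_vec_def)
    moreover have "k = 1 \<or> k = 2" using exhaust_2[of k] .
    ultimately show "((\<lambda>P. log_chart c P \<bullet> i) has_derivative (\<lambda>\<xi>. vector [2 * (beta1 P \<bullet> \<xi>), 2 * (beta2 P \<bullet> \<xi>)] \<bullet> i)) (at P within S)"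
      using d1 d2 by (auto simp: inner_axis log_chart_def)
  qed
qed

lemma inj_on_log_chart: "inj_on (log_chart c) Omega"
proof (rule inj_onI)
  fix P Q assume P: "P \<in> Omega" and Q: "Q \<in> Omega" and eq: "log_chart c P = log_chart c Q"
  have pos: "lam1 P > 0" "lam2 P > 0" "lam3 P > 0" "lam1 Q > 0" "lam2 Q > 0" "lam3 Q > 0"
    using P Q by (auto simp: Omega_eq)
  have "ln (lam1 P) - ln (lam3 P) = ln (lam1 Q) - ln (lam3 Q)" "ln (lam2 P) - ln (lam3 P) = ln (lam2 Q) - ln (lam3 Q)"
    using arg_cong[OF eq, of "\<lambda>v. v $ 1"] arg_cong[OF eq, of "\<lambda>v. v $ 2"] by (simp_all add: log_chart_def)
  then have "ln (lam1 P / lam3 P) = ln (lam1 Q / lam3 Q)" "ln (lam2 P / lam3 P) = ln (lam2 Q / lam3 Q)"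
    using pos by (simp_all add: ln_div)
  then have r: "lam1 P / lam3 P = lam1 Q / lam3 Q" "lam2 P / lam3 P = lam2 Q / lam3 Q"
    using pos by simp_all
  \<comment> \<open>Adding 1 to the two ratios gives \<open>1 / lam3\<close>, so the ratios
    determine all three coordinates.\<close>
  have "1 / lam3 P = lam1 P / lam3 P + lam2 P / lam3 P + 1"
    using pos lam_sum[of P] by (simp add: field_simps)
  moreover have "1 / lam3 Q = lam1 Q / lam3 Q + lam2 Q / lam3 Q + 1"
    using pos lam_sum[of Q] by (simp add: field_simps)
  ultimately have "1 / lam3 P = 1 / lam3 Q" using r by simp
  then have e: "lam3 P = lam3 Q" by simp
  then have "lam1 P = lam1 Q" "lam2 P = lam2 Q" using r pos by simp_all
  then show "P = Q" by (rule lam_inj)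
qed

text \<open>The Jacobian of the logarithmic chart is four times the cross product that governs the area of
  the dual unit ball: in this chart the Hilbert metric is a constant norm.\<close>

lemma holmes_thompson_log_chart:
  assumes X: "X \<subseteq> Omega" "X \<in> sets borel"
    and fin: "log_chart c ` X \<in> lmeasurable"
  shows "holmes_thompson_area Omega X = ennreal (3 / (4 * pi) * measure lebesgue (log_chart c ` X))"
proof -
  let ?d = "\<lambda>P. \<bar>det (matrix (\<lambda>\<xi>. vector [2 * (beta1 P \<bullet> \<xi>), 2 * (beta2 P \<bullet> \<xi>)] :: real^2))\<bar>"
  have d: "?d P = 4 * \<bar>cross2 (beta1 P) (beta2 P)\<bar>" for P
  proof -
    have "det (matrix (\<lambda>\<xi>. vector [2 * (beta1 P \<bullet> \<xi>), 2 * (beta2 P \<bullet> \<xi>)] :: real^2)) = 4 * cross2 (beta1 P) (beta2 P)"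
      by (simp add: det_2 matrix_def cross2_def inner_axis)
    then show ?thesis by (simp add: abs_mult)
  qed
  have "(?d has_integral measure lebesgue (log_chart c ` X)) X"
  \<comment> \<open>Change of variables for an injective differentiable map: the measure of the
    image is the integral of the Jacobian.\<close>
  proof (rule iffD1[OF has_measure_differentiable_image])
    show "X \<in> sets lebesgue" using X(2) by (metis sets_completionI_sets sets_lborel)
    show "(log_chart c has_derivative (\<lambda>\<xi>. vector [2 * (beta1 P \<bullet> \<xi>), 2 * (beta2 P \<bullet> \<xi>)])) (at P within X)"
      if "P \<in> X" for P using that X(1) log_chart_has_derivative by blast
    show "inj_on (log_chart c) X" by (rule inj_on_subset[OF inj_on_log_chart X(1)])
  qed (simp add: fin)
  then have "integral\<^sup>N lborel (\<lambda>P. ennreal (?d P) * indicator X P) = ennreal (measure lebesgue (log_chart c ` X))"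
    by (intro nn_integral_has_integral_lebesgue') auto
  then have 1: "(\<integral>\<^sup>+P. ennreal (4 * \<bar>cross2 (beta1 P) (beta2 P)\<bar>) * indicator X P \<partial>lborel) = ennreal (measure lebesgue (log_chart c ` X))"
    by (simp only: d)
  \<comment> \<open>The closed form on \<open>X\<close> consists of continuous functions. It
    supplies the measurability for pulling the constant \<open>3 / 4\<close> out of the
    integral.\<close>
  have "(\<lambda>P. ennreal (4 * \<bar>cross2 (beta1 P) (beta2 P)\<bar>) * indicator X P) = (\<lambda>P. ennreal (1 / (\<bar>D\<bar> * lam1 P * lam2 P * lam3 P)) * indicator X P)"
  proof
    fix P
    show "ennreal (4 * \<bar>cross2 (beta1 P) (beta2 P)\<bar>) * indicator X P = ennreal (1 / (\<bar>D\<bar> * lam1 P * lam2 P * lam3 P)) * indicator X P"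
    proof (cases "P \<in> X")
      case True
      then have "P \<in> Omega" using X by auto
      then show ?thesis
        by (simp add: cross2_beta abs_mult Omega_eq mult.assoc)
    qed simp
  qed
  moreover have "lam1 \<in> borel_measurable borel" "lam2 \<in> borel_measurable borel" "lam3 \<in> borel_measurable borel"
    by (rule borel_measurable_continuous_onI, rule has_derivative_continuous_on, rule lam_has_derivative)+
  ultimately have m: "(\<lambda>P. ennreal (4 * \<bar>cross2 (beta1 P) (beta2 P)\<bar>) * indicator X P) \<in> borel_measurable lborel"
    using X by simp
  have "(\<integral>\<^sup>+P\<in>X. emeasure lborel (dual_unit_ball Omega P) \<partial>lborel)
      = (\<integral>\<^sup>+P. ennreal (3 / 4) * (ennreal (4 * \<bar>cross2 (beta1 P) (beta2 P)\<bar>) * indicator X P) \<partial>lborel)"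
  proof (rule nn_integral_cong)
    fix P
    show "emeasure lborel (dual_unit_ball Omega P) * indicator X P = ennreal (3 / 4) * (ennreal (4 * \<bar>cross2 (beta1 P) (beta2 P)\<bar>) * indicator X P)"
      using X by (cases "P \<in> X") (auto simp: emeasure_dual_unit_ball simp flip: ennreal_mult)
  qed
  also have "\<dots> = ennreal (3 / 4) * ennreal (measure lebesgue (log_chart c ` X))"
    by (simp only: nn_integral_cmult[OF m] 1)
  finally show ?thesis
    by (simp add: holmes_thompson_area_def flip: ennreal_mult)
qed

end

section \<open>Inscribed triangles\<close>

text \<open>The parameters are the barycentric weights of one point on each side. The digit is the
  index of the weighted vertex in the order \<open>u\<close>, \<open>v\<close>, \<open>w\<close>;
  the one that is absent belongs to the opposite vertex.\<close>

locale inscribed = triangle +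
  fixes p1 p3 q1 q2 r2 r3 :: real
  assumes pos: "p1 > 0" "p3 > 0" "q1 > 0" "q2 > 0" "r2 > 0" "r3 > 0"
    and sums: "p1 + p3 = 1" "q1 + q2 = 1" "r2 + r3 = 1"
begin

definition p where "p = p1 *\<^sub>R u + p3 *\<^sub>R w"
definition q where "q = q1 *\<^sub>R u + q2 *\<^sub>R v"
definition r where "r = r2 *\<^sub>R v + r3 *\<^sub>R w"

text \<open>The determinant of the matrix of barycentric weights of \<open>p\<close>,
  \<open>q\<close>, \<open>r\<close>, that is, the ratio of the two oriented areas.\<close>

definition \<Delta> where "\<Delta> = p1 * q2 * r3 + p3 * q1 * r2"

lemma \<Delta>_pos: "\<Delta> > 0"
  using pos by (simp add: \<Delta>_def add_pos_pos)

sublocale inner: triangle p q r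
proof
  have p3: "p3 = 1 - p1" and q2: "q2 = 1 - q1" and r3: "r3 = 1 - r2" using sums by simp_all
  have pr: "p - r = p1 *\<^sub>R (u - w) - r2 *\<^sub>R (v - w)" and qr: "q - r = q1 *\<^sub>R (u - w) + (q2 - r2) *\<^sub>R (v - w)"
    unfolding p_def q_def r_def unfolding p3 q2 r3 by (simp_all add: algebra_simps)
  have "cross2 (p - r) (q - r) = (p1 * (q2 - r2) + r2 * q1) * cross2 (u - w) (v - w)"
  proof -
    have "cross2 (p1 *\<^sub>R a - r2 *\<^sub>R b) (q1 *\<^sub>R a + (q2 - r2) *\<^sub>R b) = (p1 * (q2 - r2) + r2 * q1) * cross2 a b" for a b
      by (simp add: cross2_def algebra_simps)
    then show ?thesis unfolding pr qr .
  qed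
  also have "p1 * (q2 - r2) + r2 * q1 = \<Delta>"
    unfolding \<Delta>_def unfolding p3 q2 r3 by (simp add: algebra_simps)
  finally show "cross2 (p - r) (q - r) \<noteq> 0"
    using \<Delta>_pos nondegenerate by simp
qed

lemma inner_point:
  "a *\<^sub>R p + b *\<^sub>R q + c *\<^sub>R r = (a * p1 + b * q1) *\<^sub>R u + (b * q2 + c * r2) *\<^sub>R v + (a * p3 + c * r3) *\<^sub>R w"
  by (simp add: p_def q_def r_def algebra_simps)

lemma inner_lam:
  "lam1 P = inner.lam1 P * p1 + inner.lam2 P * q1" "lam2 P = inner.lam2 P * q2 + inner.lam3 P * r2"
  "lam3 P = inner.lam1 P * p3 + inner.lam3 P * r3"
proof -
  let ?a = "inner.lam1 P" and ?b = "inner.lam2 P" and ?c = "inner.lam3 P"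
  have "(?a * p1 + ?b * q1) + (?b * q2 + ?c * r2) + (?a * p3 + ?c * r3)
      = ?a * (p1 + p3) + ?b * (q1 + q2) + ?c * (r2 + r3)" by (simp add: algebra_simps)
  also have "\<dots> = 1" using inner.lam_sum[of P] by (simp add: sums)
  finally have s: "(?a * p1 + ?b * q1) + (?b * q2 + ?c * r2) + (?a * p3 + ?c * r3) = 1" .
  have P: "P = (?a * p1 + ?b * q1) *\<^sub>R u + (?b * q2 + ?c * r2) *\<^sub>R v + (?a * p3 + ?c * r3) *\<^sub>R w"
    using inner.barycentric_expand[of P] unfolding inner_point .
  show "lam1 P = ?a * p1 + ?b * q1" "lam2 P = ?b * q2 + ?c * r2" "lam3 P = ?a * p3 + ?c * r3"
    using lam_point[OF s] unfolding P[symmetric] .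
qed

text \<open>Cramer's rule for the barycentric coordinates with respect to the inner triangle.\<close>

lemma inner_lam_solve:
  "\<Delta> * inner.lam1 P = q2 * r3 * lam1 P - q1 * r3 * lam2 P + q1 * r2 * lam3 P"
  "\<Delta> * inner.lam2 P = r2 * p3 * lam1 P + r3 * p1 * lam2 P - r2 * p1 * lam3 P"
  "\<Delta> * inner.lam3 P = - (p3 * q2 * lam1 P) + p3 * q1 * lam2 P + p1 * q2 * lam3 P"
  unfolding inner_lam \<Delta>_def by (simp_all add: algebra_simps)

lemma inner_Omega_iff:
  "P \<in> inner.Omega \<longleftrightarrow> q2 * r3 * lam1 P - q1 * r3 * lam2 P + q1 * r2 * lam3 P > 0
     \<and> r2 * p3 * lam1 P + r3 * p1 * lam2 P - r2 * p1 * lam3 P > 0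
     \<and> - (p3 * q2 * lam1 P) + p3 * q1 * lam2 P + p1 * q2 * lam3 P > 0"
  unfolding inner.Omega_eq mem_Collect_eq inner_lam_solve[symmetric] using \<Delta>_pos by (simp add: zero_less_mult_iff)

lemma inner_subset: "inner.Omega \<subseteq> Omega"
proof
  fix P assume "P \<in> inner.Omega"
  then show "P \<in> Omega"
    unfolding inner.Omega_eq Omega_eq mem_Collect_eq inner_lam using pos by (simp add: add_pos_pos)
qed

text \<open>The product of the ratios in which \<open>p\<close>, \<open>q\<close>, \<open>r\<close>
  divide the sides, as in Ceva's theorem. It will turn out to be the triple ratio.\<close>

definition m where "m = (q2 * p1 * r3) / (q1 * p3 * r2)"

lemma m_pos: "m > 0"
  using pos by (simp add: m_def)

text \<open>The shift moves the logarithms of the homogeneous coordinates of \<open>p\<close> and \<open>r\<close> to the origin.\<close>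

definition shift :: "real^2" where "shift = vector [ln (p1 / p3), ln (r2 / r3)]"

lemma log_chart_exp:
  assumes "P \<in> Omega"
  shows "lam1 P = lam3 P * (p1 / p3) * exp (log_chart shift P $ 1)"
    "lam2 P = lam3 P * (r2 / r3) * exp (log_chart shift P $ 2)"
  using assms pos by (auto simp: Omega_eq log_chart_def shift_def exp_diff)

text \<open>Each linear form that bounds the inner triangle becomes, in the coordinates
  \<open>s\<close> and \<open>\<tau>\<close>, a positive multiple of one of the three expressions
  that define \<open>log_region\<close>.\<close>

lemma inner_Omega_log_chart:
  assumes "P \<in> Omega"
  shows "P \<in> inner.Omega \<longleftrightarrow> (log_chart shift P $ 1, log_chart shift P $ 2) \<in> log_region m"
proof -
  define s \<tau> where "s = log_chart shift P $ 1" and "\<tau> = log_chart shift P $ 2"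
  have l: "lam1 P = lam3 P * (p1 / p3) * exp s" "lam2 P = lam3 P * (r2 / r3) * exp \<tau>"
    using log_chart_exp[OF assms] by (simp_all add: s_def \<tau>_def)
  have z: "lam3 P > 0" using assms by (simp add: Omega_eq)
  have 1: "q2 * r3 * lam1 P - q1 * r3 * lam2 P + q1 * r2 * lam3 P = (lam3 P * q1 * r2) * (1 + m * exp s - exp \<tau>)"
    unfolding l m_def using pos by (simp add: field_simps)
  have 2: "r2 * p3 * lam1 P + r3 * p1 * lam2 P - r2 * p1 * lam3 P = (lam3 P * p1 * r2) * (exp s + exp \<tau> - 1)"
    unfolding l using pos by (simp add: field_simps)
  have 3: "- (p3 * q2 * lam1 P) + p3 * q1 * lam2 P + p1 * q2 * lam3 P = (lam3 P * p3 * q1 * r2 / r3) * (exp \<tau> - m * (exp s - 1))"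
    unfolding l m_def using pos by (simp add: field_simps)
  have k: "lam3 P * q1 * r2 > 0" "lam3 P * p1 * r2 > 0" "lam3 P * p3 * q1 * r2 / r3 > 0" using pos z by simp_all
  have c: "0 < k * x \<longleftrightarrow> 0 < x" if "k > 0" for k x :: real using that by (simp add: zero_less_mult_iff)
  show ?thesis
    unfolding inner_Omega_iff 1 2 3 s_def[symmetric] \<tau>_def[symmetric] log_region_def c[OF k(1)] c[OF k(2)] c[OF k(3)]
    by auto
qed

lemma log_chart_surj: "\<exists>P\<in>Omega. log_chart shift P = (h :: real^2)"
proof -
  \<comment> \<open>\<open>X\<close>, \<open>Y\<close>, 1 are homogeneous barycentric coordinates of
    the preimage; division by their sum \<open>N\<close> normalises them.\<close>
  define X Y where "X = p1 / p3 * exp (h $ 1)" and "Y = r2 / r3 * exp (h $ 2)"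
  have XY: "X > 0" "Y > 0" using pos by (simp_all add: X_def Y_def)
  define N where "N = X + Y + 1"
  have N: "N > 0" using XY by (simp add: N_def)
  have s: "X / N + Y / N + 1 / N = 1" using N by (simp add: N_def flip: add_divide_distrib)
  define P where "P = (X / N) *\<^sub>R u + (Y / N) *\<^sub>R v + (1 / N) *\<^sub>R w"
  have l: "lam1 P = X / N" "lam2 P = Y / N" "lam3 P = 1 / N" unfolding P_def by (rule lam_point[OF s])+
  have "log_chart shift P $ i = h $ i" if "i = 1 \<or> i = 2" for i
    using that XY N pos by (auto simp: log_chart_def shift_def l ln_div ln_mult_pos X_def Y_def)
  then have "log_chart shift P = h" by (simp add: vec_eq_iff forall_2)
  moreover have "P \<in> Omega" using XY N by (simp add: Omega_eq l)
  ultimately show ?thesis by blast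
qed

lemma log_chart_image: "log_chart shift ` inner.Omega = {h :: real^2. (h $ 1, h $ 2) \<in> log_region m}"
proof (intro equalityI subsetI)
  fix h assume "h \<in> log_chart shift ` inner.Omega"
  then show "h \<in> {h. (h $ 1, h $ 2) \<in> log_region m}"
    using inner_Omega_log_chart inner_subset by auto
next
  fix h :: "real^2" assume h: "h \<in> {h. (h $ 1, h $ 2) \<in> log_region m}"
  obtain P where P: "P \<in> Omega" "log_chart shift P = h" using log_chart_surj by blast
  then have "P \<in> inner.Omega" using h inner_Omega_log_chart by auto
  then show "h \<in> log_chart shift ` inner.Omega" using P by blast
qed

theorem holmes_thompson_inscribed:
  "holmes_thompson_area Omega inner.Omega = ennreal (3 / (8 * pi) * (pi\<^sup>2 + (ln m)\<^sup>2))"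
proof -
  let ?I = "log_chart shift ` inner.Omega"
  have "(\<lambda>h. (h $ 1, h $ 2)) -` log_region m \<in> sets (borel :: (real^2) measure)"
    using measurable_sets_borel[of "\<lambda>h::real^2. (h $ 1, h $ 2)" borel "log_region m"]
    by (simp add: borel_measurable_continuous_onI continuous_intros)
  then have I: "?I \<in> sets borel" by (simp add: log_chart_image vimage_def)
  have "emeasure lborel ?I = emeasure lborel (vec2 -` ?I)"
    using I by (subst lborel_vec2) (simp add: emeasure_distr)
  also have "vec2 -` ?I = log_region m" by (simp add: log_chart_image vimage_def)
  finally have e: "emeasure lborel ?I = ennreal ((pi\<^sup>2 + (ln m)\<^sup>2) / 2)"
    by (simp add: emeasure_log_region m_pos)
  have "?I \<in> lmeasurable" using e I by (intro fmeasurableI) auto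
  moreover have "inner.Omega \<in> sets borel" unfolding inner.Omega_def by simp
  ultimately have "holmes_thompson_area Omega inner.Omega = ennreal (3 / (4 * pi) * measure lebesgue ?I)"
    by (intro holmes_thompson_log_chart inner_subset)
  also have "measure lebesgue ?I = (pi\<^sup>2 + (ln m)\<^sup>2) / 2"
    using e I by (simp add: measure_def)
  finally show ?thesis by simp
qed

end

section \<open>Triples of flags\<close>

unbundle cross3_syntax

text \<open>Planes are replaced by their normals, so that general position and the triple ratio can
  be read off from inner products.\<close>

lemma flag_normal:
  assumes "flag F" "represents f1 f2 F"
  shows "f1 \<times> f2 \<noteq> 0" "F 2 = {x. (f1 \<times> f2) \<bullet> x = 0}" "F 1 = span {f1}"
proof -
  let ?n = "f1 \<times> f2"
  have F2: "F 2 = span {f1, f2}" "dim (F 2) = 2" and F1: "F 1 = span {f1}"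
    using assms by (auto simp: flag_def represents_def)
  have "\<not> collinear {0, f1, f2}"
  proof
    assume "collinear {0, f1, f2}"
    then consider "f1 = 0" | "f2 = 0" | c where "f2 = c *\<^sub>R f1" by (auto simp: collinear_lemma)
    then have "dim (F 2) \<le> 1"
    proof cases
      case 1
      then show ?thesis using dim_le_card'[of "{f2}"] by (simp add: F2)
    next
      case 2
      then have "span {f1, f2} = span {f1}" by (simp add: insert_commute)
      then show ?thesis using dim_le_card'[of "{f1}"] by (simp add: F2)
    next
      case 3
      then have "f2 \<in> span {f1}" by (simp add: span_scale span_base)
      then have "span {f2, f1} = span {f1}" by (rule span_redundant)
      then have "span {f1, f2} = span {f1}" by (simp only: insert_commute)
      then show ?thesis using dim_le_card'[of "{f1}"] by (simp add: F2)
    qed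
    with F2 show False by simp
  qed
  then show n: "?n \<noteq> 0" by (simp add: cross_eq_0)
  have sub: "F 2 \<subseteq> {x. ?n \<bullet> x = 0}"
    unfolding F2(1)
  proof (rule span_minimal)
    show "{f1, f2} \<subseteq> {x. ?n \<bullet> x = 0}" by (auto simp: dot_cross_self)
    show "subspace {x. ?n \<bullet> x = 0}" by (rule subspace_hyperplane)
  qed
  have "dim {x. ?n \<bullet> x = 0} = 2"
    using dim_hyperplane[OF n] by simp
  then show "F 2 = {x. ?n \<bullet> x = 0}"
    using sub F2 by (intro subspace_dim_equal) (auto simp: subspace_hyperplane subspace_span)
  show "F 1 = span {f1}" by (rule F1)
qed

text \<open>A sum of vectors orthogonal to \<open>n\<close> is orthogonal to \<open>n\<close>, so
  \<open>n\<close> itself cannot be such a sum.\<close>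

lemma three_sets_in_plane:
  fixes n :: "real^3"
  assumes "A + B + C = UNIV" "n \<noteq> 0"
  shows "\<not> (A \<subseteq> {x. n \<bullet> x = 0} \<and> B \<subseteq> {x. n \<bullet> x = 0} \<and> C \<subseteq> {x. n \<bullet> x = 0})"
proof
  assume sub: "A \<subseteq> {x. n \<bullet> x = 0} \<and> B \<subseteq> {x. n \<bullet> x = 0} \<and> C \<subseteq> {x. n \<bullet> x = 0}"
  have "n \<in> A + B + C" using assms by simp
  then obtain a b c where "n = a + b + c" "a \<in> A" "b \<in> B" "c \<in> C" by (auto simp: set_plus_def)
  moreover from this have "n \<bullet> a = 0" "n \<bullet> b = 0" "n \<bullet> c = 0" using sub by blast+
  ultimately have "n \<bullet> n = 0" by (metis inner_add_right add_0)
  with assms show False by simp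
qed

text \<open>Up to a cyclic shift, each determinant pairs the normal of one flag with the line of
  another.\<close>

lemma triple_ratio_normals:
  "triple_ratio e1 e2 f1 f2 g1 g2 =
    (((e1 \<times> e2) \<bullet> f1) / ((g1 \<times> g2) \<bullet> f1)) * (((g1 \<times> g2) \<bullet> e1) / ((f1 \<times> f2) \<bullet> e1)) * (((f1 \<times> f2) \<bullet> g1) / ((e1 \<times> e2) \<bullet> g1))"
proof -
  have "det3 x y z = (x \<times> y) \<bullet> z" "det3 x y z = (y \<times> z) \<bullet> x" for x y z
    unfolding det3_def dot_cross_det[symmetric] by (simp_all add: cross3_simps)
  then show ?thesis unfolding triple_ratio_def by metis
qed

lemma cross3_expand:
  fixes a b c x :: "real^3"
  shows "(a \<bullet> (b \<times> c)) *\<^sub>R x = (a \<bullet> x) *\<^sub>R (b \<times> c) + (b \<bullet> x) *\<^sub>R (c \<times> a) + (c \<bullet> x) *\<^sub>R (a \<times> b)"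
  by (simp add: cross3_simps forall_3)

lemma cross3_expand_dual:
  fixes a b c x :: "real^3"
  shows "(a \<bullet> (b \<times> c)) *\<^sub>R x = (x \<bullet> (b \<times> c)) *\<^sub>R a + (x \<bullet> (c \<times> a)) *\<^sub>R b + (x \<bullet> (a \<times> b)) *\<^sub>R c"
  by (simp add: cross3_simps forall_3)

text \<open>If the three planes had a common line, the triple ratio would be \<open>-1\<close>: a linear relation
  between the normals, evaluated at \<open>e\<close>, \<open>f\<close> and \<open>g\<close>, determines the three quotients.\<close>

lemma normals_independent:
  fixes nE nF nG e f g :: "real^3"
  assumes "nE \<bullet> e = 0" "nF \<bullet> f = 0" "nG \<bullet> g = 0"
    and nz: "nE \<bullet> f \<noteq> 0" "nE \<bullet> g \<noteq> 0" "nF \<bullet> e \<noteq> 0" "nF \<bullet> g \<noteq> 0" "nG \<bullet> e \<noteq> 0" "nG \<bullet> f \<noteq> 0"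
    and T: "(nE \<bullet> f / (nG \<bullet> f)) * (nG \<bullet> e / (nF \<bullet> e)) * (nF \<bullet> g / (nE \<bullet> g)) \<noteq> -1"
  shows "nE \<bullet> (nF \<times> nG) \<noteq> 0"
proof
  assume d: "nE \<bullet> (nF \<times> nG) = 0"
  define U where "U = nE \<times> nF"
  \<comment> \<open>As \<open>f\<close> lies in the plane of \<open>nF\<close> but not in that of
    \<open>nE\<close>, this is a nonzero multiple of \<open>nF\<close>. Hence
    \<open>U \<noteq> 0\<close>, and the relation between the normals has a nonzero coefficient
    \<open>c\<close>.\<close>
  have "U \<times> f = (nE \<bullet> f) *\<^sub>R nF - (nF \<bullet> f) *\<^sub>R nE"
    unfolding U_def by (simp add: cross3_simps forall_3)
  moreover have "nF \<noteq> 0" using nz by auto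
  ultimately have "U \<noteq> 0" using assms by auto
  define a b c where "a = U \<bullet> (nF \<times> nG)" and "b = U \<bullet> (nG \<times> nE)" and "c = U \<bullet> U"
  have "c \<noteq> 0" using \<open>U \<noteq> 0\<close> by (simp add: c_def)
  have rel: "a *\<^sub>R nE + b *\<^sub>R nF + c *\<^sub>R nG = 0"
    using cross3_expand_dual[of nE nF nG U] by (simp add: d a_def b_def c_def U_def)
  have r: "a * (nE \<bullet> x) + b * (nF \<bullet> x) + c * (nG \<bullet> x) = 0" for x
    using arg_cong[OF rel, of "\<lambda>y. y \<bullet> x"] by (simp add: inner_add_left)
  have re: "b * (nF \<bullet> e) = - c * (nG \<bullet> e)" and rf: "a * (nE \<bullet> f) = - c * (nG \<bullet> f)" and rg: "b * (nF \<bullet> g) = - a * (nE \<bullet> g)"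
    using r[of e] r[of f] r[of g] assms by simp_all
  then have "a \<noteq> 0" "b \<noteq> 0" using \<open>c \<noteq> 0\<close> nz by auto
  have "nG \<bullet> e / (nF \<bullet> e) = - b / c" "nE \<bullet> f / (nG \<bullet> f) = - c / a" "nF \<bullet> g / (nE \<bullet> g) = - a / b"
    using re rf rg nz \<open>a \<noteq> 0\<close> \<open>b \<noteq> 0\<close> \<open>c \<noteq> 0\<close> by (simp_all add: field_simps)
  then show False using T \<open>a \<noteq> 0\<close> \<open>b \<noteq> 0\<close> \<open>c \<noteq> 0\<close> by simp
qed

section \<open>Existence of a chart with inscribed triangles\<close>

lemma chart_coords_span:
  assumes "invertible A" "A *v y = k *\<^sub>R vector [x $ 1, x $ 2, 1]" "k \<noteq> 0"
  shows "chart_coords A (span {y}) x"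
proof -
  have "(\<lambda>v. A *v v) ` span {y} = span {A *v y}"
    using linear_span_image[OF matrix_vector_mul_linear[of A], of "{y}"] by simp
  also have "\<dots> = span {vector [x $ 1, x $ 2, 1]}"
  proof -
    let ?z = "vector [x $ 1, x $ 2, 1] :: real^3"
    have "(1 / k) *\<^sub>R (k *\<^sub>R ?z) \<in> span {k *\<^sub>R ?z}" by (intro span_scale span_base) simp
    then have "?z \<in> span {k *\<^sub>R ?z}" using assms(3) by simp
    moreover have "k *\<^sub>R ?z \<in> span {?z}" by (intro span_scale span_base) simp
    ultimately show ?thesis
      unfolding assms(2) by (intro equalityI span_minimal) (auto simp: subspace_span)
  qed
  finally show ?thesis using assms(1) by (simp add: chart_coords_def)
qed

lemma same_sign_ratio:
  fixes x y :: real
  assumes "x * y > 0"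
  shows "x + y \<noteq> 0" "0 < x / (x + y)" "x / (x + y) < 1" "1 - x / (x + y) = y / (x + y)"
    "0 < y / (x + y)" "y / (x + y) < 1" "1 - y / (x + y) = x / (x + y)"
proof -
  have "(x > 0 \<and> y > 0) \<or> (x < 0 \<and> y < 0)" using assms by (auto simp: zero_less_mult_iff)
  then show *: "x + y \<noteq> 0" "0 < x / (x + y)" "x / (x + y) < 1" "0 < y / (x + y)" "y / (x + y) < 1"
    by (auto simp: field_simps zero_less_divide_iff)
  then show "1 - x / (x + y) = y / (x + y)" "1 - y / (x + y) = x / (x + y)" by (simp_all add: field_simps)
qed

text \<open>The three normals, suitably scaled, serve as homogeneous barycentric coordinates. The
  chart in which their sum is 1 sends the outer triangle to the standard triangle.\<close>

lemma inscribed_triangles_exist: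
  fixes nE nF nG e f g :: "real^3"
  assumes E: "E 1 = span {e}" "E 2 = {x. nE \<bullet> x = 0}" and F: "F 1 = span {f}" "F 2 = {x. nF \<bullet> x = 0}"
    and G: "G 1 = span {g}" "G 2 = {x. nG \<bullet> x = 0}"
    and inc: "nE \<bullet> e = 0" "nF \<bullet> f = 0" "nG \<bullet> g = 0"
    and nz: "nE \<bullet> f \<noteq> 0" "nE \<bullet> g \<noteq> 0" "nF \<bullet> e \<noteq> 0" "nF \<bullet> g \<noteq> 0" "nG \<bullet> e \<noteq> 0" "nG \<bullet> f \<noteq> 0"
    and T: "(nE \<bullet> f / (nG \<bullet> f)) * (nG \<bullet> e / (nF \<bullet> e)) * (nF \<bullet> g / (nE \<bullet> g)) > 0"
  shows "\<exists>A Pin Pout. inscribed_triangles E F G A Pin Pout"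
proof -
  define d where "d = nE \<bullet> (nF \<times> nG)"
  have d: "d \<noteq> 0" unfolding d_def by (rule normals_independent[OF inc nz]) (use T in linarith)
  have d2: "nF \<bullet> (nG \<times> nE) = d" "nG \<bullet> (nE \<times> nF) = d"
    unfolding d_def by (simp_all add: cross3_simps)
  \<comment> \<open>With the sign of \<open>lW\<close> fixed, the other two signs are chosen so that
    the two forms that do not vanish at \<open>e\<close>, and likewise at \<open>g\<close>, agree in
    sign there.\<close>
  define \<epsilon>U \<epsilon>V where "\<epsilon>U = sgn ((nG \<bullet> e) * (nF \<bullet> e))" and "\<epsilon>V = sgn ((nE \<bullet> g) * (nF \<bullet> g))"
  define lU lV lW where "lU x = \<epsilon>U * (nG \<bullet> x) / d" and "lV x = \<epsilon>V * (nE \<bullet> x) / d" and "lW x = (nF \<bullet> x) / d" for x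
  have sg: "\<epsilon>U \<noteq> 0" "\<epsilon>V \<noteq> 0" using nz by (auto simp: \<epsilon>U_def \<epsilon>V_def sgn_eq_0_iff)
  have abs_pos: "sgn x * x > 0" if "x \<noteq> 0" for x :: real using that by (simp add: sgn_if)
  have "lU e * lW e = (\<epsilon>U * ((nG \<bullet> e) * (nF \<bullet> e))) / d\<^sup>2" by (simp add: lU_def lW_def power2_eq_square)
  then have se: "lU e * lW e > 0" unfolding \<epsilon>U_def using abs_pos[of "(nG \<bullet> e) * (nF \<bullet> e)"] nz d by simp
  have "lV g * lW g = (\<epsilon>V * ((nE \<bullet> g) * (nF \<bullet> g))) / d\<^sup>2" by (simp add: lV_def lW_def power2_eq_square)
  then have sg': "lV g * lW g > 0" unfolding \<epsilon>V_def using abs_pos[of "(nE \<bullet> g) * (nF \<bullet> g)"] nz d by simp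
  have den: "0 < (nG \<bullet> f)\<^sup>2 * (nF \<bullet> e)\<^sup>2 * (nE \<bullet> g)\<^sup>2" using nz by simp
  \<comment> \<open>Over a denominator of squares, the sign of the triple ratio is a product of
    three signs, one for each of \<open>f\<close>, \<open>e\<close>, \<open>g\<close>. Those at
    \<open>e\<close> and \<open>g\<close> are \<open>\<epsilon>U\<close> and
    \<open>\<epsilon>V\<close>, so positivity is precisely agreement of signs at
    \<open>f\<close>.\<close>
  have "(nE \<bullet> f / (nG \<bullet> f)) * (nG \<bullet> e / (nF \<bullet> e)) * (nF \<bullet> g / (nE \<bullet> g))
      = ((nE \<bullet> f) * (nG \<bullet> f)) * ((nG \<bullet> e) * (nF \<bullet> e)) * ((nE \<bullet> g) * (nF \<bullet> g)) / ((nG \<bullet> f)\<^sup>2 * (nF \<bullet> e)\<^sup>2 * (nE \<bullet> g)\<^sup>2)"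
    using nz by (simp add: power2_eq_square)
  then have "0 < ((nE \<bullet> f) * (nG \<bullet> f)) * ((nG \<bullet> e) * (nF \<bullet> e)) * ((nE \<bullet> g) * (nF \<bullet> g))"
    using T den by (metis zero_less_divide_iff less_asym)
  then have "0 < sgn (((nE \<bullet> f) * (nG \<bullet> f)) * ((nG \<bullet> e) * (nF \<bullet> e)) * ((nE \<bullet> g) * (nF \<bullet> g)))" by (simp only: sgn_greater)
  then have "0 < sgn ((\<epsilon>U * \<epsilon>V) * ((nE \<bullet> f) * (nG \<bullet> f)))"
    by (simp add: sgn_mult \<epsilon>U_def \<epsilon>V_def mult_ac)
  moreover have "lU f * lV f = (\<epsilon>U * \<epsilon>V) * ((nE \<bullet> f) * (nG \<bullet> f)) / d\<^sup>2"
    by (simp add: lU_def lV_def power2_eq_square)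
  ultimately have sf: "lU f * lV f > 0" using d by (simp only: sgn_greater) simp
  have zero: "lV e = 0" "lW f = 0" "lU g = 0" by (simp_all add: lU_def lV_def lW_def inc)
  define A :: "real^3^3" where
    "A = vector [(\<epsilon>U / d) *\<^sub>R nG, (\<epsilon>V / d) *\<^sub>R nE, (\<epsilon>U / d) *\<^sub>R nG + (\<epsilon>V / d) *\<^sub>R nE + (1 / d) *\<^sub>R nF]"
  have A: "A *v x = vector [lU x, lV x, lU x + lV x + lW x]" for x
    by (simp add: vec_eq_iff forall_3 A_def matrix_vector_mul_component inner_add_left lU_def lV_def lW_def)
  have ker: "x = 0" if "nE \<bullet> x = 0" "nF \<bullet> x = 0" "nG \<bullet> x = 0" for x
    using cross3_expand[of nE nF nG x] that d by (simp add: d_def)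
  have "x = 0" if "A *v x = 0" for x
  proof (rule ker)
    have "lU x = 0" "lV x = 0" "lU x + lV x + lW x = 0"
      using that unfolding A vec_eq_iff forall_3 by simp_all
    then show "nE \<bullet> x = 0" "nF \<bullet> x = 0" "nG \<bullet> x = 0" using sg d by (simp_all add: lU_def lV_def lW_def)
  qed
  then have inv: "invertible A"
    unfolding invertible_left_inverse matrix_left_invertible_ker by blast
  have planes: "E 2 \<inter> F 2 = span {nE \<times> nF}" "F 2 \<inter> G 2 = span {nF \<times> nG}" "G 2 \<inter> E 2 = span {nG \<times> nE}"
  proof -
    have *: "{x. a \<bullet> x = 0} \<inter> {x. b \<bullet> x = 0} = span {a \<times> b}" if "a \<bullet> (b \<times> c) = d" for a b c :: "real^3"
    proof (intro equalityI subsetI)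
      fix x assume "x \<in> {x. a \<bullet> x = 0} \<inter> {x. b \<bullet> x = 0}"
      then have "d *\<^sub>R x = (c \<bullet> x) *\<^sub>R (a \<times> b)" using cross3_expand[of a b c x] that by simp
      then have "x = ((c \<bullet> x) / d) *\<^sub>R (a \<times> b)"
        using d by (metis (no_types, lifting) divide_inverse_commute scaleR_scaleR left_inverse scaleR_one)
      then show "x \<in> span {a \<times> b}" unfolding span_singleton by blast
    next
      fix x assume "x \<in> span {a \<times> b}"
      then show "x \<in> {x. a \<bullet> x = 0} \<inter> {x. b \<bullet> x = 0}" by (auto simp: span_singleton dot_cross_self)
    qed
    show "E 2 \<inter> F 2 = span {nE \<times> nF}" "F 2 \<inter> G 2 = span {nF \<times> nG}" "G 2 \<inter> E 2 = span {nG \<times> nE}"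
      unfolding E F G using *[of nE nF nG] *[of nF nG nE] *[of nG nE nF] by (simp_all only: d2 d_def[symmetric])
  qed
  define u v w :: "real^2" where "u = vector [1, 0]" and "v = vector [0, 1]" and "w = vector [0, 0]"
  define p q r :: "real^2" where "p = vector [lU e / (lU e + lW e), 0]"
    and "q = vector [lU f / (lU f + lV f), lV f / (lU f + lV f)]" and "r = vector [0, lV g / (lV g + lW g)]"
  note R = same_sign_ratio[OF se] same_sign_ratio[OF sf] same_sign_ratio[OF sg']
  have "chart_coords A (E 1) p"
    unfolding E by (rule chart_coords_span[OF inv, of _ "lU e + lW e"])
      (use R in \<open>simp_all add: A p_def zero vec_eq_iff forall_3\<close>)
  moreover have "chart_coords A (F 1) q"
    unfolding F by (rule chart_coords_span[OF inv, of _ "lU f + lV f"])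
      (use R in \<open>simp_all add: A q_def zero vec_eq_iff forall_3\<close>)
  moreover have "chart_coords A (G 1) r"
    unfolding G by (rule chart_coords_span[OF inv, of _ "lV g + lW g"])
      (use R in \<open>simp_all add: A r_def zero vec_eq_iff forall_3\<close>)
  \<comment> \<open>At each vertex only one of the three forms is nonzero. Its value there,
    \<open>\<epsilon>U\<close>, \<open>\<epsilon>V\<close> or 1, is the scaling factor.\<close>
  moreover have "chart_coords A (E 2 \<inter> F 2) u"
    unfolding planes by (rule chart_coords_span[OF inv, of _ \<epsilon>U])
      (use d sg in \<open>simp_all add: A u_def vec_eq_iff forall_3 lU_def lV_def lW_def d2 dot_cross_self\<close>)
  moreover have "chart_coords A (F 2 \<inter> G 2) v"
    unfolding planes by (rule chart_coords_span[OF inv, of _ \<epsilon>V])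
      (use d sg in \<open>simp_all add: A v_def vec_eq_iff forall_3 lU_def lV_def lW_def d_def dot_cross_self\<close>)
  moreover have "chart_coords A (G 2 \<inter> E 2) w"
    unfolding planes by (rule chart_coords_span[OF inv, of _ 1])
      (use d sg in \<open>simp_all add: A w_def vec_eq_iff forall_3 lU_def lV_def lW_def d2 dot_cross_self\<close>)
  moreover have "p \<in> open_segment w u"
    unfolding in_segment using R
    by (intro conjI exI[of _ "lU e / (lU e + lW e)"]) (auto simp: p_def w_def u_def vec_eq_iff forall_2)
  moreover have "q \<in> open_segment u v"
    unfolding in_segment using R
    by (intro conjI exI[of _ "lV f / (lU f + lV f)"]) (auto simp: q_def u_def v_def vec_eq_iff forall_2)
  moreover have "r \<in> open_segment v w"
    unfolding in_segment using R
    by (intro conjI exI[of _ "lW g / (lV g + lW g)"]) (auto simp: r_def v_def w_def vec_eq_iff forall_2)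
  ultimately show ?thesis unfolding inscribed_triangles_def by blast
qed

section \<open>The area in an arbitrary chart\<close>

lemma cross2_eq_0_imp:
  assumes "cross2 a b = 0" "a \<noteq> 0"
  shows "\<exists>k. b = k *\<^sub>R a"
proof -
  have e: "a $ 1 * b $ 2 = a $ 2 * b $ 1" using assms(1) by (simp add: cross2_def)
  have "a $ 1 \<noteq> 0 \<or> a $ 2 \<noteq> 0" using assms(2) by (auto simp: vec_eq_iff forall_2)
  then show ?thesis
  proof
    assume "a $ 1 \<noteq> 0"
    then have "b = (b $ 1 / a $ 1) *\<^sub>R a" using e by (simp add: vec_eq_iff forall_2 field_simps)
    then show ?thesis by blast
  next
    assume "a $ 2 \<noteq> 0"
    then have "b = (b $ 2 / a $ 2) *\<^sub>R a" using e by (simp add: vec_eq_iff forall_2 field_simps)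
    then show ?thesis by blast
  qed
qed

lemma chart_coords_rep:
  assumes "chart_coords A L x"
  obtains X where "X \<in> L" "A *v X = vector [x $ 1, x $ 2, 1]"
proof -
  have "vector [x $ 1, x $ 2, 1] \<in> (\<lambda>v. A *v v) ` L"
    using assms unfolding chart_coords_def by (simp add: span_base)
  then show thesis using that by auto
qed

lemma chart_coords_scale:
  assumes "chart_coords A (span {y}) x"
  obtains k where "A *v y = k *\<^sub>R vector [x $ 1, x $ 2, 1]"
proof -
  have "A *v y \<in> (\<lambda>v. A *v v) ` span {y}" by (simp add: span_base)
  then have "A *v y \<in> span {vector [x $ 1, x $ 2, 1]}" using assms unfolding chart_coords_def by simp
  then show thesis using that by (auto simp: span_singleton)
qed

text \<open>For representatives with last coordinate 1, affine combinations in the chart lift to the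
  same combinations of vectors.\<close>

lemma chart_segment:
  fixes A :: "real^3^3" and x y :: "real^2"
  assumes "A *v X = vector [x $ 1, x $ 2, 1]" "A *v Y = vector [y $ 1, y $ 2, 1]"
  shows "A *v (a *\<^sub>R X + (1 - a) *\<^sub>R Y) = vector [(a *\<^sub>R x + (1 - a) *\<^sub>R y) $ 1, (a *\<^sub>R x + (1 - a) *\<^sub>R y) $ 2, 1]"
  by (simp add: matrix_vector_right_distrib matrix_vector_mult_scaleR assms vec_eq_iff forall_3)

text \<open>The vectors of the lines are, up to scale, affine combinations of lifts
  \<open>U\<close>, \<open>V\<close>, \<open>W\<close> of the outer vertices. In the triple ratio
  the scales and the values of the normals at these lifts cancel, so it is the product of the
  division ratios of the sides.\<close>

lemma holmes_thompson_inscribed_triangles: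
  fixes nE nF nG e f g :: "real^3"
  assumes E: "E 1 = span {e}" "E 2 = {x. nE \<bullet> x = 0}" and F: "F 1 = span {f}" "F 2 = {x. nF \<bullet> x = 0}"
    and G: "G 1 = span {g}" "G 2 = {x. nG \<bullet> x = 0}"
    and nz: "nE \<bullet> f \<noteq> 0" "nE \<bullet> g \<noteq> 0" "nF \<bullet> e \<noteq> 0" "nF \<bullet> g \<noteq> 0" "nG \<bullet> e \<noteq> 0" "nG \<bullet> f \<noteq> 0"
    and T: "(nE \<bullet> f / (nG \<bullet> f)) * (nG \<bullet> e / (nF \<bullet> e)) * (nF \<bullet> g / (nE \<bullet> g)) = t"
    and "inscribed_triangles E F G A Pin Pout"
  shows "holmes_thompson_area Pout Pin = ennreal (3 / (8 * pi) * (pi\<^sup>2 + (ln t)\<^sup>2))"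
proof -
  obtain p q r u v w where
    pqr: "chart_coords A (E 1) p" "chart_coords A (F 1) q" "chart_coords A (G 1) r" and
    uvw: "chart_coords A (E 2 \<inter> F 2) u" "chart_coords A (F 2 \<inter> G 2) v" "chart_coords A (G 2 \<inter> E 2) w" and
    seg: "p \<in> open_segment w u" "q \<in> open_segment u v" "r \<in> open_segment v w" and
    P: "Pin = interior (convex hull {p, q, r})" "Pout = interior (convex hull {u, v, w})"
    using assms unfolding inscribed_triangles_def by blast
  obtain U where U: "U \<in> E 2 \<inter> F 2" "A *v U = vector [u $ 1, u $ 2, 1]" using uvw(1) by (rule chart_coords_rep)
  obtain V where V: "V \<in> F 2 \<inter> G 2" "A *v V = vector [v $ 1, v $ 2, 1]" using uvw(2) by (rule chart_coords_rep)
  obtain W where W: "W \<in> G 2 \<inter> E 2" "A *v W = vector [w $ 1, w $ 2, 1]" using uvw(3) by (rule chart_coords_rep)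
  have z: "nE \<bullet> U = 0" "nF \<bullet> U = 0" "nF \<bullet> V = 0" "nG \<bullet> V = 0" "nG \<bullet> W = 0" "nE \<bullet> W = 0"
    using U V W by (auto simp: E F G)
  have inj: "X = Y" if "A *v X = A *v Y" for X Y
    using pqr(1) that unfolding chart_coords_def invertible_def
    by (metis matrix_vector_mul_assoc matrix_vector_mul_lid)
  obtain a where a: "0 < a" "a < 1" "p = a *\<^sub>R u + (1 - a) *\<^sub>R w"
    using seg(1) by (auto simp: in_segment add.commute)
  obtain b where b: "0 < b" "b < 1" "q = b *\<^sub>R v + (1 - b) *\<^sub>R u"
    using seg(2) by (auto simp: in_segment add.commute)
  obtain c where c: "0 < c" "c < 1" "r = c *\<^sub>R w + (1 - c) *\<^sub>R v"
    using seg(3) by (auto simp: in_segment add.commute)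
  obtain ke where "A *v e = ke *\<^sub>R vector [p $ 1, p $ 2, 1]" using pqr(1) unfolding E by (rule chart_coords_scale)
  then have "A *v e = A *v (ke *\<^sub>R (a *\<^sub>R U + (1 - a) *\<^sub>R W))"
    unfolding matrix_vector_mult_scaleR chart_segment[OF U(2) W(2)] a(3) .
  then have e: "e = ke *\<^sub>R (a *\<^sub>R U + (1 - a) *\<^sub>R W)" by (rule inj)
  obtain kf where "A *v f = kf *\<^sub>R vector [q $ 1, q $ 2, 1]" using pqr(2) unfolding F by (rule chart_coords_scale)
  then have "A *v f = A *v (kf *\<^sub>R (b *\<^sub>R V + (1 - b) *\<^sub>R U))"
    unfolding matrix_vector_mult_scaleR chart_segment[OF V(2) U(2)] b(3) .
  then have f: "f = kf *\<^sub>R (b *\<^sub>R V + (1 - b) *\<^sub>R U)" by (rule inj)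
  obtain kg where "A *v g = kg *\<^sub>R vector [r $ 1, r $ 2, 1]" using pqr(3) unfolding G by (rule chart_coords_scale)
  then have "A *v g = A *v (kg *\<^sub>R (c *\<^sub>R W + (1 - c) *\<^sub>R V))"
    unfolding matrix_vector_mult_scaleR chart_segment[OF W(2) V(2)] c(3) .
  then have g: "g = kg *\<^sub>R (c *\<^sub>R W + (1 - c) *\<^sub>R V)" by (rule inj)
  have ev: "nE \<bullet> f = kf * b * (nE \<bullet> V)" "nG \<bullet> f = kf * (1 - b) * (nG \<bullet> U)"
    "nG \<bullet> e = ke * a * (nG \<bullet> U)" "nF \<bullet> e = ke * (1 - a) * (nF \<bullet> W)"
    "nF \<bullet> g = kg * c * (nF \<bullet> W)" "nE \<bullet> g = kg * (1 - c) * (nE \<bullet> V)"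
    unfolding e f g by (simp_all add: inner_add_right z)
  have nz': "nE \<bullet> V \<noteq> 0" "nG \<bullet> U \<noteq> 0" "nF \<bullet> W \<noteq> 0" "ke \<noteq> 0" "kf \<noteq> 0" "kg \<noteq> 0" using nz unfolding ev by auto
  have t: "t = (b * a * c) / ((1 - b) * (1 - a) * (1 - c))"
  proof -
    have "(kf * b * x / (kf * b' * y)) * (ke * a * y / (ke * a' * z)) * (kg * c * z / (kg * c' * x)) = (b * a * c) / (b' * a' * c')"
      if "x \<noteq> 0" "y \<noteq> 0" "z \<noteq> 0" for x y z a' b' c' :: real
      using that nz' by (simp add: mult_ac)
    then show ?thesis using T nz' unfolding ev by metis
  qed
  have nondeg: "cross2 (u - w) (v - w) \<noteq> 0"
  proof
    assume "cross2 (u - w) (v - w) = 0"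
    moreover have "u - w \<noteq> 0" using seg(1) by (auto simp: in_segment)
    ultimately obtain k where "v - w = k *\<^sub>R (u - w)" using cross2_eq_0_imp by blast
    then have v: "v = k *\<^sub>R u + (1 - k) *\<^sub>R w" by (simp add: algebra_simps)
    \<comment> \<open>Collinear outer vertices would put \<open>V\<close> in the plane through
      \<open>U\<close> and \<open>W\<close>, which is \<open>E 2\<close>; but
      \<open>nE \<bullet> V\<close> is nonzero.\<close>
    have "A *v V = A *v (k *\<^sub>R U + (1 - k) *\<^sub>R W)"
      unfolding chart_segment[OF U(2) W(2)] V(2) v ..
    then have "V = k *\<^sub>R U + (1 - k) *\<^sub>R W" by (rule inj)
    then have "nE \<bullet> V = 0" by (simp add: inner_add_right z)
    with nz' show False by simp
  qed
  \<comment> \<open>With these weights \<open>I.m\<close> is literally the expression found for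
    \<open>t\<close>.\<close>
  interpret I: inscribed u v w a "1 - a" "1 - b" b "1 - c" c
    using nondeg a b c by unfold_locales auto
  have "I.p = p" "I.q = q" "I.r = r"
    by (simp_all add: I.p_def I.q_def I.r_def a(3) b(3) c(3) add.commute)
  then have "Pout = I.Omega" "Pin = I.inner.Omega"
    unfolding P I.Omega_def I.inner.Omega_def by simp_all
  moreover have "I.m = t" unfolding I.m_def t ..
  ultimately show ?thesis using I.holmes_thompson_inscribed by simp
qed

text \<open>The first conjunct rules out that the second holds vacuously. The second covers every
  admissible chart, so the value does not depend on its choice.\<close>

theorem corollary1p7:
  fixes E F G :: "nat \<Rightarrow> (real^3) set"
    and e1 e2 f1 f2 g1 g2 :: "real^3"
    and t :: real
  assumes "flag E" and "flag F" and "flag G"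
    and "represents e1 e2 E" and "represents f1 f2 F" and "represents g1 g2 G"
    and "general_position E F G"
    and "triple_ratio e1 e2 f1 f2 g1 g2 = t"
    and "t > 0"
  shows "(\<exists>A Pin Pout. inscribed_triangles E F G A Pin Pout) \<and>
         (\<forall>A Pin Pout. inscribed_triangles E F G A Pin Pout \<longrightarrow>
            holmes_thompson_area Pout Pin = ennreal (3 / (8 * pi) * (pi\<^sup>2 + (ln t)\<^sup>2)))"
proof -
  define nE nF nG where "nE = e1 \<times> e2" and "nF = f1 \<times> f2" and "nG = g1 \<times> g2"
  note nE = flag_normal[OF assms(1,4), folded nE_def]
  note nF = flag_normal[OF assms(2,5), folded nF_def]
  note nG = flag_normal[OF assms(3,6), folded nG_def]
  have zero: "H 0 = {0}" if "flag H" for H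
  proof -
    have "subspace (H 0)" "dim (H 0) = 0" using that by (auto simp: flag_def)
    then show ?thesis using subspace_0 by (auto simp: dim_eq_0)
  qed
  have line: "span {x} \<subseteq> {y. n \<bullet> y = 0}" if "n \<bullet> x = 0" for n x :: "real^3"
    using that by (auto simp: span_singleton)
  have gp: "E a + F b + G c = UNIV" if "a \<le> 2" "b \<le> 2" "c \<le> 2" "a + b + c = 3" for a b c
    using assms(7) that unfolding general_position_def by blast
  have inc: "nE \<bullet> e1 = 0" "nF \<bullet> f1 = 0" "nG \<bullet> g1 = 0"
    by (simp_all add: nE_def nF_def nG_def dot_cross_self)
  note in_plane = three_sets_in_plane[OF gp]
  \<comment> \<open>If one of these products vanished, general position with indices 2, 1, 0 in a
    suitable order would put a plane, a line in it and the zero space into one plane.\<close>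
  have nz: "nE \<bullet> f1 \<noteq> 0" "nE \<bullet> g1 \<noteq> 0" "nF \<bullet> e1 \<noteq> 0" "nF \<bullet> g1 \<noteq> 0" "nG \<bullet> e1 \<noteq> 0" "nG \<bullet> f1 \<noteq> 0"
    using in_plane[of 2 1 0 nE] in_plane[of 2 0 1 nE] in_plane[of 1 2 0 nF] in_plane[of 0 2 1 nF]
      in_plane[of 1 0 2 nG] in_plane[of 0 1 2 nG] line nE nF nG
      zero[OF assms(1)] zero[OF assms(2)] zero[OF assms(3)]
    by auto
  have T: "(nE \<bullet> f1 / (nG \<bullet> f1)) * (nG \<bullet> e1 / (nF \<bullet> e1)) * (nF \<bullet> g1 / (nE \<bullet> g1)) = t"
    using assms(8) by (simp only: triple_ratio_normals nE_def nF_def nG_def)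
  show ?thesis
  proof (intro conjI allI impI)
    show "\<exists>A Pin Pout. inscribed_triangles E F G A Pin Pout"
      using inscribed_triangles_exist[OF nE(3,2) nF(3,2) nG(3,2) inc nz] T assms(9) by simp
    show "holmes_thompson_area Pout Pin = ennreal (3 / (8 * pi) * (pi\<^sup>2 + (ln t)\<^sup>2))"
      if "inscribed_triangles E F G A Pin Pout" for A Pin Pout
      by (rule holmes_thompson_inscribed_triangles[OF nE(3,2) nF(3,2) nG(3,2) nz T that])
  qed
qed

end
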